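(* Let $n\ge1$ and let $\alpha,\beta\in\mathbb C^n$ satisfy $\Re\alpha_j+\Re\beta_j>-1$ and $\alpha_j,\beta_j\notin\{-1,-2,\ldots\}$ for all $1\le j\le n$. Let $u=P_{\alpha,\beta}[d\mu]$ where $\mu$ is a complex Borel measure on $\mathbb T^n$. Then $u_{\mathbf r}\,dm_n$ converges weak$^\ast$ to $d\mu$ as $\mathbf r=(r_1,\ldots,r_n)\to(1,\ldots,1)$ in $[0,1)^n$.
   Context: $\mathbb D$ is the open unit disc and $\mathbb T$ the unit circle; $m_n$ is the normalized Haar measure on $\mathbb T^n$. For $u:\mathbb D^n\to\mathbb C$ and $\mathbf r\in[0,1)^n$, $u_{\mathbf r}(\zeta)=u(r_1\zeta_1,\ldots,r_n\zeta_n)$, $\zeta\in\mathbb T^n$. The space $\mathcal M(\mathbb T^n)$ of complex Borel measures on $\mathbb T^n$ is the dual of $C(\mathbb T^n)$ via $\langle\varphi,d\mu\rangle=\int_{\mathbb T^n}\varphi\,d\mu$; weak$^\ast$ convergence refers to this duality. The $(\alpha,\beta)$-Poisson kernel is, for $z\in\mathbb D^n$, $\zeta\in\mathbb T^n$ (principal branches of powers), $$P_{\alpha,\beta}(z,\zeta)=\prod_{j=1}^n c_{\alpha_j,\beta_j}\frac{(1-|z_j|^2)^{\alpha_j+\beta_j+1}}{(1-z_j\overline{\zeta_j})^{\alpha_j+1}(1-\overline{z_j}\zeta_j)^{\beta_j+1}},\qquad c_{a,b}=\frac{\Gamma(a+1)\Gamma(b+1)}{\Gamma(a+b+1)},$$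 and $P_{\alpha,\beta}[d\mu](z)=\int_{\mathbb T^n}P_{\alpha,\beta}(z,\zeta)\,d\mu(\zeta)$, $z\in\mathbb D^n$. *)

theory Defs
  imports "HOL-Probability.Probability"
begin

section \<open>Complex measures\<close>

text \<open>
  A complex measure is a countably additive complex-valued set function on the measurable sets
  of \<open>M\<close>; only the \<open>\<sigma>\<close>-algebra of \<open>M\<close> is relevant. (The value 0 at the empty set follows, as the
  constant sequence of empty sets is disjoint and its series must converge.)
\<close>
definition complex_measure :: "'a measure \<Rightarrow> ('a set \<Rightarrow> complex) \<Rightarrow> bool" where
  "complex_measure M \<mu> \<longleftrightarrow>
     (\<forall>A :: nat \<Rightarrow> 'a set. range A \<subseteq> sets M \<longrightarrow> disjoint_family A \<longrightarrow>
        (\<lambda>i. \<mu> (A i)) sums \<mu> (\<Union>i. A i))"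

text \<open>
  The upper variation of a real set function. For a finite signed measure \<open>\<nu>\<close>, its Jordan
  decomposition is \<open>\<nu> = upper_variation M \<nu> - upper_variation M (-\<nu>)\<close>. Negative values of \<open>\<nu>\<close> are
  sent to 0 by \<open>ennreal\<close>, which is harmless as the empty set competes in the supremum.
\<close>
definition upper_variation :: "'a measure \<Rightarrow> ('a set \<Rightarrow> real) \<Rightarrow> 'a measure" where
  "upper_variation M \<nu> =
     measure_of (space M) (sets M) (\<lambda>A. SUP B\<in>{B \<in> sets M. B \<subseteq> A}. ennreal (\<nu> B))"

definition signed_integral :: "'a measure \<Rightarrow> ('a set \<Rightarrow> real) \<Rightarrow> ('a \<Rightarrow> complex) \<Rightarrow> complex" where
  "signed_integral M \<nu> f =
     (LINT x|upper_variation M \<nu>. f x) - (LINT x|upper_variation M (\<lambda>A. - \<nu> A). f x)"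

definition complex_measure_integral ::
    "'a measure \<Rightarrow> ('a set \<Rightarrow> complex) \<Rightarrow> ('a \<Rightarrow> complex) \<Rightarrow> complex" where
  "complex_measure_integral M \<mu> f =
     signed_integral M (\<lambda>A. Re (\<mu> A)) f + \<i> * signed_integral M (\<lambda>A. Im (\<mu> A)) f"

text \<open>The complex measure \<open>f dm\<close>.\<close>
definition density_measure :: "'a measure \<Rightarrow> ('a \<Rightarrow> complex) \<Rightarrow> 'a set \<Rightarrow> complex" where
  "density_measure m f A = (LINT x:A|m. f x)"

text \<open>
  Weak* convergence of complex Borel measures on \<open>K\<close> (meant for compact \<open>K\<close>, where these measures
  form the dual of \<open>C(K)\<close>).
\<close>
definition weak_star_tendsto ::
    "'a::topological_space set \<Rightarrow> ('b \<Rightarrow> 'a set \<Rightarrow> complex) \<Rightarrow> ('a set \<Rightarrow> complex) \<Rightarrow> 'b filter \<Rightarrow> bool"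
  where
  "weak_star_tendsto K \<nu> \<mu> F \<longleftrightarrow>
     (\<forall>\<^sub>F r in F. complex_measure (restrict_space borel K) (\<nu> r)) \<and>
     complex_measure (restrict_space borel K) \<mu> \<and>
     (\<forall>\<phi> :: 'a \<Rightarrow> complex. continuous_on K \<phi> \<longrightarrow>
        ((\<lambda>r. complex_measure_integral (restrict_space borel K) (\<nu> r) \<phi>) \<longlongrightarrow>
           complex_measure_integral (restrict_space borel K) \<mu> \<phi>) F)"

text \<open>For a finite positive measure the integral above is the usual one.\<close>
lemma upper_variation_measure:
  assumes "finite_measure N" "sets N = sets M"
  shows "upper_variation M (measure N) = N"
proof -
  interpret finite_measure N by fact
  have sp: "space N = space M"
    using assms(2) by (rule sets_eq_imp_space_eq)
  have "(SUP B\<in>{B \<in> sets M. B \<subseteq> A}. ennreal (measure N B)) = emeasure N A"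
    if "A \<in> sets M" for A
  proof (rule antisym)
    show "(SUP B\<in>{B \<in> sets M. B \<subseteq> A}. ennreal (measure N B)) \<le> emeasure N A"
      using that assms(2) by (auto intro!: SUP_least emeasure_mono simp flip: emeasure_eq_measure)
    show "emeasure N A \<le> (SUP B\<in>{B \<in> sets M. B \<subseteq> A}. ennreal (measure N B))"
      using that by (auto intro!: SUP_upper2[of A] simp: emeasure_eq_measure)
  qed
  then have "upper_variation M (measure N) = measure_of (space M) (sets M) (emeasure N)"
    unfolding upper_variation_def
    by (intro measure_of_eq) (auto simp: sets.space_closed sets.sigma_sets_eq)
  also have "\<dots> = N"
    using measure_of_of_measure[of N] assms(2) sp by simp
  finally show ?thesis .
qed

lemma complex_measure_integral_measure:
  assumes "finite_measure N" "sets N = sets M"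
  shows "complex_measure_integral M (\<lambda>A. complex_of_real (measure N A)) f = (LINT x|N. f x)"
proof -
  have null: "(LINT x|upper_variation M (\<lambda>A. - \<nu> A). f x) = 0"
    if "\<And>A. \<nu> A \<ge> 0" for \<nu> :: "'a set \<Rightarrow> real"
  proof -
    have eq: "upper_variation M (\<lambda>A. - \<nu> A) = measure_of (space M) (sets M) (\<lambda>_. 0)"
      unfolding upper_variation_def
      using that by (intro measure_of_eq) (auto simp: sets.space_closed ennreal_neg sets.sigma_sets_eq
          intro!: SUP_eq_const)
    have "emeasure (upper_variation M (\<lambda>A. - \<nu> A)) A = 0" for A
      unfolding eq by (simp add: emeasure_sigma)
    then have "AE x in upper_variation M (\<lambda>A. - \<nu> A). f x = 0"
      by (intro AE_I[where N="space (upper_variation M (\<lambda>A. - \<nu> A))"]) auto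
    then show ?thesis
      by (rule integral_eq_zero_AE)
  qed
  show ?thesis
    using null[of "\<lambda>_. 0"] null[of "measure N"] upper_variation_measure[OF assms]
    by (simp add: complex_measure_integral_def signed_integral_def)
qed


section \<open>The torus and its normalized Haar measure\<close>

definition torus :: "(complex ^ 'n) set" where
  "torus = {\<zeta>. \<forall>j. norm (\<zeta> $ j) = 1}"

definition polydisc :: "(complex ^ 'n) set" where
  "polydisc = {z. \<forall>j. norm (z $ j) < 1}"

abbreviation torus_borel :: "(complex ^ 'n) measure" where
  "torus_borel \<equiv> restrict_space borel torus"

text \<open>The arc-length measure \<open>dt/(2\<pi>)\<close> on the unit circle.\<close>
definition circle_haar :: "complex measure" where
  "circle_haar =
     distr (uniform_measure lborel {0..<2 * pi}) (restrict_space borel (sphere 0 1)) cis"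

definition torus_haar :: "(complex ^ 'n::finite) measure" where
  "torus_haar = distr (Pi\<^sub>M UNIV (\<lambda>_::'n. circle_haar)) torus_borel vec_lambda"

lemma sets_circle_haar [simp, measurable_cong]:
  "sets circle_haar = sets (restrict_space borel (sphere 0 1))"
  by (simp add: circle_haar_def)

lemma space_circle_haar [simp]: "space circle_haar = sphere 0 1"
  by (simp add: circle_haar_def space_restrict_space)

lemma sets_torus_haar [simp, measurable_cong]: "sets torus_haar = sets torus_borel"
  by (simp add: torus_haar_def)

lemma cis_measurable_circle [measurable]: "cis \<in> lborel \<rightarrow>\<^sub>M restrict_space borel (sphere 0 1)"
  by (intro measurable_restrict_space2)
     (auto intro!: borel_measurable_continuous_onI continuous_intros)

lemma cis_measurable_uniform [measurable]:
  "cis \<in> uniform_measure lborel S \<rightarrow>\<^sub>M restrict_space borel (sphere 0 1)"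
  using cis_measurable_circle by (simp cong: measurable_cong_sets)

lemma prob_space_circle_haar: "prob_space circle_haar"
  unfolding circle_haar_def
  by (intro prob_space.prob_space_distr prob_space_uniform_measure cis_measurable_uniform) auto

lemma vec_lambda_measurable_torus [measurable]:
  "vec_lambda \<in> Pi\<^sub>M UNIV (\<lambda>_::'n::finite. circle_haar) \<rightarrow>\<^sub>M torus_borel"
proof (intro measurable_restrict_space2)
  have comp: "(\<lambda>f. f i) \<in> borel_measurable (Pi\<^sub>M UNIV (\<lambda>_::'n. circle_haar))" for i
  proof -
    have "(\<lambda>x. x) \<in> circle_haar \<rightarrow>\<^sub>M borel"
      by (simp add: circle_haar_def measurable_restrict_space1)
    from measurable_compose[OF measurable_component_singleton[of _ UNIV "\<lambda>_::'n. circle_haar"] this]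
    show ?thesis
      by simp
  qed
  show "vec_lambda \<in> borel_measurable (Pi\<^sub>M UNIV (\<lambda>_::'n. circle_haar))"
    unfolding borel_measurable_euclidean_space[where 'c="complex ^ 'n"]
    using comp by (auto simp: Basis_vec_def inner_axis intro!: borel_measurable_inner)
qed (auto simp: torus_def space_PiM PiE_iff)

lemma prob_space_torus_haar: "prob_space torus_haar"
proof -
  interpret prob_space circle_haar by (rule prob_space_circle_haar)
  interpret P: prob_space "Pi\<^sub>M UNIV (\<lambda>_::'n. circle_haar)"
    by (intro prob_space_PiM) unfold_locales
  show ?thesis
    unfolding torus_haar_def by (intro P.prob_space_distr vec_lambda_measurable_torus)
qed

lemma circle_haar_rotate:
  assumes "norm w = 1"
  shows "distr circle_haar circle_haar ((*) w) = circle_haar"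
proof (rule measure_eqI)
  fix A assume "A \<in> sets (distr circle_haar circle_haar ((*) w))"
  then have A: "A \<in> sets (restrict_space borel (sphere 0 1))"
    by simp
  obtain s where s: "0 \<le> s" "s < 2 * pi" "w = cis s"
    using assms cis_Arg_unique Arg2pi[of w] by (auto simp: cis_conv_exp is_Arg_def)
  define B where "B = cis -` A"
  have B [measurable]: "B \<in> sets lborel"
    using measurable_sets[OF cis_measurable_circle A] by (simp add: B_def)
  have per: "t + 2 * pi \<in> B \<longleftrightarrow> t \<in> B" for t
    by (simp add: B_def flip: cis_mult)
  have trans: "emeasure lborel X = emeasure lborel {t. c + t \<in> X}" if "X \<in> sets lborel"
    for X and c :: real
    using that by (subst (1) lborel_distr_plus[of c, symmetric])
      (subst emeasure_distr, auto simp: vimage_def)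
  have haar: "emeasure circle_haar X = emeasure lborel ({0..<2*pi} \<inter> cis -` X) / ennreal (2 * pi)"
    if "X \<in> sets (restrict_space borel (sphere 0 1))" for X
    using that measurable_sets[OF cis_measurable_circle that]
    by (simp add: circle_haar_def emeasure_distr)
  have rot: "(*) w \<in> restrict_space borel (sphere 0 1) \<rightarrow>\<^sub>M restrict_space borel (sphere 0 1)"
    using assms by (intro measurable_restrict_space2 measurable_restrict_space1)
      (auto simp: space_restrict_space norm_mult)
  define A' where "A' = (*) w -` A \<inter> sphere 0 1"
  have A': "A' \<in> sets (restrict_space borel (sphere 0 1))"
    using measurable_sets[OF rot A] by (simp add: A'_def space_restrict_space)
  have "emeasure lborel ({0..<2*pi} \<inter> cis -` A') = emeasure lborel {t. s + t \<in> {s..<s+2*pi} \<inter> B}"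
    by (rule arg_cong[where f="emeasure lborel"]) (auto simp: A'_def B_def s cis_mult)
  also have "\<dots> = emeasure lborel ({s..<s+2*pi} \<inter> B)"
    by (rule trans[symmetric]) auto
  also have "\<dots> = emeasure lborel (({s..<2*pi} \<inter> B) \<union> ({2*pi..<s+2*pi} \<inter> B))"
    using s by (intro arg_cong[where f="emeasure lborel"]) auto
  also have "\<dots> = emeasure lborel ({s..<2*pi} \<inter> B) + emeasure lborel ({2*pi..<s+2*pi} \<inter> B)"
    by (intro plus_emeasure[symmetric]) auto
  also have "emeasure lborel ({2*pi..<s+2*pi} \<inter> B) =
      emeasure lborel {t. 2*pi + t \<in> {2*pi..<s+2*pi} \<inter> B}"
    by (rule trans) auto
  also have "{t. 2*pi + t \<in> {2*pi..<s+2*pi} \<inter> B} = {0..<s} \<inter> B"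
    using per by (auto simp: add.commute)
  also have "emeasure lborel ({s..<2*pi} \<inter> B) + emeasure lborel ({0..<s} \<inter> B) =
      emeasure lborel (({s..<2*pi} \<inter> B) \<union> ({0..<s} \<inter> B))"
    by (intro plus_emeasure) auto
  also have "({s..<2*pi} \<inter> B) \<union> ({0..<s} \<inter> B) = {0..<2*pi} \<inter> B"
    using s by auto
  finally have "emeasure circle_haar A' = emeasure circle_haar A"
    using haar[OF A] haar[OF A'] by (simp add: B_def)
  then show "emeasure (distr circle_haar circle_haar ((*) w)) A = emeasure circle_haar A"
    using A rot by (subst emeasure_distr) (auto simp: A'_def cong: measurable_cong_sets)
qed simp

lemma torus_haar_rotate:
  fixes w :: "complex ^ 'n::finite"
  assumes w: "w \<in> torus"
  shows "distr torus_haar torus_borel (\<lambda>\<zeta>. \<chi> j. w $ j * \<zeta> $ j) = torus_haar"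
proof -
  let ?P = "Pi\<^sub>M UNIV (\<lambda>_::'n. circle_haar)"
  let ?R = "\<lambda>f j. w $ j * f j"
  interpret C: prob_space circle_haar by (rule prob_space_circle_haar)
  interpret product_prob_space "\<lambda>_::'n. circle_haar" UNIV by unfold_locales
  have rot: "(*) (w $ j) \<in> circle_haar \<rightarrow>\<^sub>M circle_haar" for j
  proof -
    have "(*) (w $ j) \<in> restrict_space borel (sphere 0 1) \<rightarrow>\<^sub>M restrict_space borel (sphere 0 1)"
      using w by (intro measurable_restrict_space2 measurable_restrict_space1)
        (auto simp: space_restrict_space norm_mult torus_def)
    then show ?thesis
      by (simp cong: measurable_cong_sets)
  qed
  have R: "?R \<in> ?P \<rightarrow>\<^sub>M ?P"
    using w rot by (intro measurable_PiM_single')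
      (auto intro: measurable_compose[
          OF measurable_component_singleton[of _ UNIV "\<lambda>_::'n. circle_haar"] rot]
        simp: space_PiM PiE_iff norm_mult torus_def)
  have inv: "distr ?P ?P ?R = ?P"
  proof (rule PiM_eqI)
    fix A :: "'n \<Rightarrow> complex set"
    assume A: "\<And>i. i \<in> UNIV \<Longrightarrow> A i \<in> sets circle_haar"
    let ?A = "\<lambda>i. (*) (w $ i) -` A i \<inter> space circle_haar"
    have "emeasure (distr ?P ?P ?R) (Pi\<^sub>E UNIV A) = emeasure ?P (?R -` Pi\<^sub>E UNIV A \<inter> space ?P)"
      using A by (intro emeasure_distr R sets_PiM_I_finite) auto
    also have "?R -` Pi\<^sub>E UNIV A \<inter> space ?P = Pi\<^sub>E UNIV ?A"
      by (auto simp: space_PiM PiE_iff)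
    also have "emeasure ?P \<dots> = (\<Prod>i\<in>UNIV. emeasure circle_haar (?A i))"
      using A by (intro emeasure_PiM measurable_sets[OF rot]) auto
    also have "\<dots> = (\<Prod>i\<in>UNIV. emeasure circle_haar (A i))"
    proof (rule prod.cong[OF refl])
      fix i :: 'n
      have "norm (w $ i) = 1"
        using w by (simp add: torus_def)
      from arg_cong[OF circle_haar_rotate[OF this], of "\<lambda>M. emeasure M (A i)"]
      show "emeasure circle_haar (?A i) = emeasure circle_haar (A i)"
        using A[of i] by (subst (asm) emeasure_distr[OF rot]) auto
    qed
    finally show "emeasure (distr ?P ?P ?R) (Pi\<^sub>E UNIV A) =
        (\<Prod>i\<in>UNIV. emeasure circle_haar (A i))" .
  qed auto
  have W: "(\<lambda>\<zeta>. \<chi> j. w $ j * \<zeta> $ j) \<in> torus_borel \<rightarrow>\<^sub>M torus_borel"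
    using w by (intro measurable_restrict_space2 measurable_restrict_space1
        borel_measurable_continuous_onI continuous_intros)
      (auto simp: space_restrict_space norm_mult torus_def)
  have "distr torus_haar torus_borel (\<lambda>\<zeta>. \<chi> j. w $ j * \<zeta> $ j) =
      distr ?P torus_borel (\<lambda>f. \<chi> j. w $ j * f j)"
    unfolding torus_haar_def
    by (subst distr_distr[OF W vec_lambda_measurable_torus]) (simp add: comp_def)
  also have "\<dots> = distr (distr ?P ?P ?R) torus_borel vec_lambda"
    by (subst distr_distr[OF vec_lambda_measurable_torus R]) (simp add: comp_def)
  finally show ?thesis
    by (simp add: inv torus_haar_def)
qed


section \<open>The \<open>(\<alpha>,\<beta>)\<close>-Poisson kernel\<close>

definition poisson_const :: "complex \<Rightarrow> complex \<Rightarrow> complex" where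
  "poisson_const a b = Gamma (a + 1) * Gamma (b + 1) / Gamma (a + b + 1)"

text \<open>
  On \<open>complex\<close>, \<open>powr\<close> is the principal branch; for \<open>z\<close> in the polydisc and \<open>\<zeta>\<close> on the torus all
  bases lie in the open right half-plane.
\<close>
definition poisson_kernel ::
    "complex ^ 'n::finite \<Rightarrow> complex ^ 'n \<Rightarrow> complex ^ 'n \<Rightarrow> complex ^ 'n \<Rightarrow> complex" where
  "poisson_kernel \<alpha> \<beta> z \<zeta> =
     (\<Prod>j\<in>UNIV. poisson_const (\<alpha> $ j) (\<beta> $ j) *
        (complex_of_real (1 - (norm (z $ j))\<^sup>2) powr (\<alpha> $ j + \<beta> $ j + 1) /
         ((1 - z $ j * cnj (\<zeta> $ j)) powr (\<alpha> $ j + 1) *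
          (1 - cnj (z $ j) * \<zeta> $ j) powr (\<beta> $ j + 1))))"

definition poisson_integral ::
    "complex ^ 'n::finite \<Rightarrow> complex ^ 'n \<Rightarrow> ((complex ^ 'n) set \<Rightarrow> complex) \<Rightarrow> complex ^ 'n \<Rightarrow> complex"
  where
  "poisson_integral \<alpha> \<beta> \<mu> z = complex_measure_integral torus_borel \<mu> (poisson_kernel \<alpha> \<beta> z)"

definition dilated :: "(complex ^ 'n \<Rightarrow> complex) \<Rightarrow> real ^ 'n \<Rightarrow> complex ^ 'n \<Rightarrow> complex" where
  "dilated u r \<zeta> = u (\<chi> j. complex_of_real (r $ j) * \<zeta> $ j)"

end

theory Submission
  imports Defs
begin

text \<open>
  On a dilate of the torus the Poisson integral of \<open>\<mu>\<close> is a convolution on the group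
  \<^const>\<open>torus\<close>: the kernel at \<open>(r \<zeta>, \<eta>)\<close> is a product \<open>K\<^sub>r(\<zeta> / \<eta>)\<close> of one-dimensional factors. For a
  continuous \<open>\<phi>\<close>, Fubini's theorem and invariance of Haar measure therefore give
  \<open>\<integral> \<phi> u\<^sub>r dm = \<integral> \<phi>\<^sub>r d\<mu>\<close>, where \<open>\<phi>\<^sub>r(\<eta>) = \<integral> \<phi>(\<eta> w) K\<^sub>r(w) dm(w)\<close>. It suffices that \<open>\<phi>\<^sub>r\<close> tends to \<open>\<phi>\<close>
  uniformly on the torus, that is, that \<open>K\<^sub>r\<close> is an approximate identity
  (\<open>torus_kernel_approximate_identity\<close>).

  All that needs computation is one-dimensional. Expanding the two powers in the denominator into
  binomial series and integrating over the circle produces a power series in \<open>r\<^sup>2\<close> with coefficients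
  \<open>(a+1)\<^sub>n (b+1)\<^sub>n / n!\<^sup>2\<close>. By Euler's limit for the Gamma function these are asymptotically a constant
  times the binomial coefficients of \<open>(1 - x)\<^bsup>-(a+b+1)\<^esup>\<close>, and an Abelian comparison shows that the
  integral of the normalized kernel tends to 1 (\<open>tendsto_poisson_factor_integral\<close>). Up to a constant
  the modulus of the factor is at most \<open>(1 - r\<^sup>2)\<^sup>s / |1 - r w|\<^bsup>s+1\<^esup>\<close> with \<open>s = Re a + Re b + 1 > 0\<close>. This
  majorant is, up to its constant, again a kernel of the family, with both parameters
  \<open>(s - 1) / 2\<close>, so its mass converges by the same computation; and it tends to 0 uniformly away from \<open>w = 1\<close> because \<open>s > 0\<close>.

  Integration against a complex measure is defined by upper variations. A complex measure is bounded
  (\<open>complex_measure_bounded\<close>), so \<open>\<mu>\<close> is represented by four finite positive measures; and for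
  a measure \<open>f dm\<close> the variations are computed explicitly, so that its integral of \<open>\<phi>\<close> is the
  integral of \<open>\<phi> f\<close> (\<open>complex_measure_integral_density_measure\<close>).
\<close>

section \<open>Complex measures: boundedness, and integration against a density\<close>

lemma complex_measure_empty:
  assumes "complex_measure M \<mu>"
  shows "\<mu> {} = 0"
proof -
  have "(\<lambda>_::nat. \<mu> {}) sums \<mu> {}"
    using assms[unfolded complex_measure_def, rule_format, of "\<lambda>_. {}"]
    by (simp add: disjoint_family_on_def)
  then show ?thesis
    using summable_const_iff[of "\<mu> {}"] sums_summable by blast
qed

lemma complex_measure_Un:
  assumes cm: "complex_measure M \<mu>" and "A \<in> sets M" "B \<in> sets M" "A \<inter> B = {}"
  shows "\<mu> (A \<union> B) = \<mu> A + \<mu> B"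
proof -
  have "(\<lambda>i. \<mu> (binaryset A B i)) sums \<mu> (\<Union>i. binaryset A B i)"
    using assms by (intro cm[unfolded complex_measure_def, rule_format])
      (auto simp: binaryset_def disjoint_family_on_def)
  moreover have "(\<lambda>i. \<mu> (binaryset A B i)) sums (\<mu> A + \<mu> B)"
    using complex_measure_empty[OF cm] by (rule binaryset_sums)
  ultimately show ?thesis
    by (simp add: UN_binaryset_eq sums_iff)
qed

text \<open>
  Call a set bad if \<open>\<mu>\<close> is unbounded on its measurable subsets. A bad set \<open>A\<close> has a subset \<open>B\<close> with
  \<open>\<bar>\<mu> B\<bar>\<close> much larger than \<open>\<bar>\<mu> A\<bar>\<close>, so \<open>B\<close> and \<open>A - B\<close> both have measure at least 1 in modulus, and
  one of the two is bad again. If the whole space were bad, splitting off the other half over and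
  over would produce disjoint sets whose measures stay away from 0, although they form a convergent
  series.
\<close>
lemma complex_measure_bounded:
  assumes cm: "complex_measure M \<mu>"
  shows "\<exists>K. \<forall>B\<in>sets M. norm (\<mu> B) \<le> K"
proof (rule ccontr)
  assume unbounded: "\<not> ?thesis"
  define bad where "bad A \<longleftrightarrow> A \<in> sets M \<and> (\<forall>K. \<exists>B\<in>sets M. B \<subseteq> A \<and> norm (\<mu> B) > K)" for A
  have start: "bad (space M)"
    using unbounded sets.sets_into_space unfolding bad_def by (metis not_less sets.top)
  have step: "\<exists>A'. bad A' \<and> A' \<subseteq> A \<and> norm (\<mu> (A - A')) \<ge> 1" if A: "bad A" for A
  proof -
    obtain B where B: "B \<in> sets M" "B \<subseteq> A" "norm (\<mu> B) > norm (\<mu> A) + 1"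
      using A unfolding bad_def by blast
    have AM: "A \<in> sets M" using A by (simp add: bad_def)
    have "\<mu> A = \<mu> B + \<mu> (A - B)"
      using complex_measure_Un[OF cm, of B "A - B"] AM B by (simp add: Un_absorb1)
    then have "\<mu> B = \<mu> A - \<mu> (A - B)" by simp
    then have big: "norm (\<mu> (A - B)) \<ge> 1"
      using B(3) norm_triangle_ineq4[of "\<mu> A" "\<mu> (A - B)"] by simp
    have "bad B \<or> bad (A - B)"
    proof (rule ccontr)
      assume "\<not> ?thesis"
      then obtain K1 K2 where K: "\<And>C. C \<in> sets M \<Longrightarrow> C \<subseteq> B \<Longrightarrow> norm (\<mu> C) \<le> K1"
        "\<And>C. C \<in> sets M \<Longrightarrow> C \<subseteq> A - B \<Longrightarrow> norm (\<mu> C) \<le> K2"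
        using B AM unfolding bad_def by (metis not_less sets.Diff)
      obtain C where C: "C \<in> sets M" "C \<subseteq> A" "norm (\<mu> C) > K1 + K2"
        using A unfolding bad_def by blast
      have "\<mu> C = \<mu> (C \<inter> B) + \<mu> (C - B)"
        using complex_measure_Un[OF cm, of "C \<inter> B" "C - B"] C B by (simp add: Int_Diff_Un Int_Diff_disjoint)
      moreover have "norm (\<mu> (C \<inter> B)) \<le> K1" "norm (\<mu> (C - B)) \<le> K2"
        using C B by (auto intro!: K)
      ultimately show False
        using C(3) norm_triangle_ineq[of "\<mu> (C \<inter> B)" "\<mu> (C - B)"] by simp
    qed
    then show ?thesis
    proof
      assume "bad B"
      then have "bad B \<and> B \<subseteq> A \<and> norm (\<mu> (A - B)) \<ge> 1"
        using B big by simp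
      then show ?thesis by blast
    next
      assume "bad (A - B)"
      moreover have "A - (A - B) = B" using B by auto
      moreover have "norm (\<mu> B) \<ge> 1" using B(3) norm_ge_zero[of "\<mu> A"] by linarith
      ultimately show ?thesis by (intro exI[of _ "A - B"]) auto
    qed
  qed
  have "\<exists>A. \<forall>n. bad (A n) \<and> A (Suc n) \<subseteq> A n \<and> norm (\<mu> (A n - A (Suc n))) \<ge> 1"
    using start step by (intro dependent_nat_choice) blast+
  then obtain A where A: "\<And>n. bad (A n)"
    "\<And>n::nat. A (Suc n) \<subseteq> A n \<and> norm (\<mu> (A n - A (Suc n))) \<ge> 1"
    by blast
  have dec: "A n \<subseteq> A m" if "m \<le> n" for m n
    by (rule lift_Suc_antimono_le[of A, OF conjunct1[OF A(2)] that])
  have "(A m - A (Suc m)) \<inter> (A n - A (Suc n)) = {}" if "m < n" for m n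
    using dec[of "Suc m" n] that by auto
  then have "disjoint_family (\<lambda>n. A n - A (Suc n))"
    unfolding disjoint_family_on_def using nat_neq_iff by (simp add: Int_commute) blast
  moreover have "range (\<lambda>n. A n - A (Suc n)) \<subseteq> sets M"
    using A(1) by (auto simp: bad_def)
  ultimately have "(\<lambda>n. \<mu> (A n - A (Suc n))) sums \<mu> (\<Union>n. A n - A (Suc n))"
    using cm by (simp add: complex_measure_def)
  then have "(\<lambda>n. \<mu> (A n - A (Suc n))) \<longlonglongrightarrow> 0"
    using sums_summable summable_LIMSEQ_zero by blast
  then have "\<forall>\<^sub>F n in sequentially. norm (\<mu> (A n - A (Suc n))) < 1"
    using tendsto_norm_zero order_tendstoD(2) zero_less_one by blast
  then show False
    using A(2) by (auto simp: eventually_sequentially not_less[symmetric])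
qed

lemma sets_upper_variation [simp]: "sets (upper_variation M \<nu>) = sets M"
  by (simp add: upper_variation_def)

text \<open>
  The construction \<^const>\<open>measure_of\<close> returns a measure for any set function, the null one if the
  given function fails to be countably additive. So finiteness comes down to the total mass.
\<close>
lemma finite_measure_upper_variation:
  assumes "\<And>B. B \<in> sets M \<Longrightarrow> \<nu> B \<le> K"
  shows "finite_measure (upper_variation M \<nu>)"
proof
  have "(SUP B\<in>{B \<in> sets M. B \<subseteq> space M}. ennreal (\<nu> B)) \<le> ennreal K"
    using assms by (auto intro!: SUP_least ennreal_leI)
  also have "\<dots> < \<infinity>" by simp
  finally have "(SUP B\<in>{B \<in> sets M. B \<subseteq> space M}. ennreal (\<nu> B)) \<noteq> \<infinity>" by (rule less_imp_neq)
  then show "emeasure (upper_variation M \<nu>) (space (upper_variation M \<nu>)) \<noteq> \<infinity>"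
    by (simp add: upper_variation_def emeasure_measure_of_conv del: SUP_eq_top_iff)
qed

text \<open>
  Integration against \<open>\<mu>\<close> is a fixed combination of integrations against four finite positive
  measures; limits and Fubini's theorem can then be handled for each of them.
\<close>
lemma complex_measure_integral_decomposition:
  assumes "complex_measure M \<mu>"
  obtains N1 N2 N3 N4 where
    "finite_measure N1" "sets N1 = sets M" "finite_measure N2" "sets N2 = sets M"
    "finite_measure N3" "sets N3 = sets M" "finite_measure N4" "sets N4 = sets M"
    "\<And>f. complex_measure_integral M \<mu> f =
       ((LINT x|N1. f x) - (LINT x|N2. f x)) + \<i> * ((LINT x|N3. f x) - (LINT x|N4. f x))"
proof -
  obtain K where K: "\<And>B. B \<in> sets M \<Longrightarrow> norm (\<mu> B) \<le> K"
    using complex_measure_bounded[OF assms] by blast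
  have "\<bar>Re (\<mu> B)\<bar> \<le> K" "\<bar>Im (\<mu> B)\<bar> \<le> K" if "B \<in> sets M" for B
    using K[OF that] abs_Re_le_cmod[of "\<mu> B"] abs_Im_le_cmod[of "\<mu> B"] by linarith+
  then have "finite_measure (upper_variation M (\<lambda>A. Re (\<mu> A)))"
    "finite_measure (upper_variation M (\<lambda>A. - Re (\<mu> A)))"
    "finite_measure (upper_variation M (\<lambda>A. Im (\<mu> A)))"
    "finite_measure (upper_variation M (\<lambda>A. - Im (\<mu> A)))"
    by (auto intro!: finite_measure_upper_variation[of M _ K] simp: abs_le_iff)
  then show thesis
    by (intro that[of "upper_variation M (\<lambda>A. Re (\<mu> A))" "upper_variation M (\<lambda>A. - Re (\<mu> A))"
          "upper_variation M (\<lambda>A. Im (\<mu> A))" "upper_variation M (\<lambda>A. - Im (\<mu> A))"])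
      (auto simp: complex_measure_integral_def signed_integral_def)
qed

text \<open>
  Among the subsets of \<open>A\<close>, the integral of \<open>g\<close> is largest over \<open>A \<inter> {g > 0}\<close>, where it equals the
  integral of the positive part of \<open>g\<close> over \<open>A\<close>.
\<close>
lemma upper_variation_density:
  fixes g :: "'a \<Rightarrow> real"
  assumes g: "integrable m g" and sets: "sets m = sets M"
  shows "upper_variation M (\<lambda>A. LINT x:A|m. g x) = density m (\<lambda>x. max 0 (g x))"
proof -
  have sp: "space m = space M" using sets by (rule sets_eq_imp_space_eq)
  note [measurable] = borel_measurable_integrable[OF g]
  have int_pos: "integrable m (\<lambda>x. max 0 (g x))" using g by (intro integrable_max) auto
  have eq: "(SUP B\<in>{B \<in> sets M. B \<subseteq> A}. ennreal (LINT x:B|m. g x)) =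
      emeasure (density m (\<lambda>x. max 0 (g x))) A" if A: "A \<in> sets M" for A
  proof -
    have A' [measurable]: "A \<in> sets m" using A sets by simp
    define P where "P = A \<inter> {x \<in> space m. g x > 0}"
    have P [measurable]: "P \<in> sets m" unfolding P_def by measurable
    have "emeasure (density m (\<lambda>x. max 0 (g x))) A = (\<integral>\<^sup>+x. ennreal (indicator A x *\<^sub>R max 0 (g x)) \<partial>m)"
      by (subst emeasure_density) (auto intro!: nn_integral_cong split: split_indicator)
    also have "\<dots> = ennreal (LINT x:A|m. max 0 (g x))"
      unfolding set_lebesgue_integral_def
      by (intro nn_integral_eq_integral integrable_mult_indicator int_pos) auto
    finally have em: "emeasure (density m (\<lambda>x. max 0 (g x))) A = ennreal (LINT x:A|m. max 0 (g x))" .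
    have eqP: "(LINT x:A|m. max 0 (g x)) = (LINT x:P|m. g x)"
      unfolding set_lebesgue_integral_def
      by (intro Bochner_Integration.integral_cong) (auto simp: P_def split: split_indicator)
    show ?thesis
    proof (rule antisym)
      show "(SUP B\<in>{B \<in> sets M. B \<subseteq> A}. ennreal (LINT x:B|m. g x)) \<le>
          emeasure (density m (\<lambda>x. max 0 (g x))) A"
        unfolding em
      proof (intro SUP_least ennreal_leI)
        fix B assume "B \<in> {B \<in> sets M. B \<subseteq> A}"
        then have B: "B \<in> sets m" "B \<subseteq> A" using sets by auto
        show "(LINT x:B|m. g x) \<le> (LINT x:A|m. max 0 (g x))"
          unfolding set_lebesgue_integral_def
          using B by (intro integral_mono integrable_mult_indicator g int_pos A')
            (auto split: split_indicator)
      qed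
      show "emeasure (density m (\<lambda>x. max 0 (g x))) A \<le>
          (SUP B\<in>{B \<in> sets M. B \<subseteq> A}. ennreal (LINT x:B|m. g x))"
        unfolding em eqP using P sets by (intro SUP_upper) (auto simp: P_def)
    qed
  qed
  have "upper_variation M (\<lambda>A. LINT x:A|m. g x) =
      measure_of (space M) (sets M) (emeasure (density m (\<lambda>x. max 0 (g x))))"
    unfolding upper_variation_def using eq
    by (intro measure_of_eq) (auto simp: sets.space_closed sets.sigma_sets_eq)
  also have "\<dots> = density m (\<lambda>x. max 0 (g x))"
    using measure_of_of_measure[of "density m (\<lambda>x. max 0 (g x))"] sets sp by simp
  finally show ?thesis .
qed

lemma upper_variation_cong:
  assumes "\<And>A. A \<in> sets M \<Longrightarrow> \<nu> A = \<nu>' A"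
  shows "upper_variation M \<nu> = upper_variation M \<nu>'"
  unfolding upper_variation_def using assms
  by (intro measure_of_eq SUP_cong) (auto simp: sets.space_closed sets.sigma_sets_eq)

text \<open>
  The variations of \<open>g dm\<close> and of \<open>- g dm\<close> have the densities \<open>max 0 g\<close> and \<open>max 0 (- g)\<close>, whose
  difference is \<open>g\<close>.
\<close>
lemma signed_integral_density:
  fixes g :: "'a \<Rightarrow> real" and f :: "'a \<Rightarrow> complex"
  assumes g: "integrable m g" and sets: "sets m = sets M"
    and f: "f \<in> borel_measurable m" and bound: "\<And>x. x \<in> space m \<Longrightarrow> norm (f x) \<le> K"
  shows "signed_integral M (\<lambda>A. LINT x:A|m. g x) f = (LINT x|m. complex_of_real (g x) * f x)"
proof -
  note [measurable] = borel_measurable_integrable[OF g] f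
  have neg: "upper_variation M (\<lambda>A. - (LINT x:A|m. g x)) = density m (\<lambda>x. max 0 (- g x))"
  proof -
    have "upper_variation M (\<lambda>A. - (LINT x:A|m. g x)) = upper_variation M (\<lambda>A. LINT x:A|m. - g x)"
      by (simp add: set_lebesgue_integral_def)
    then show ?thesis
      using upper_variation_density[of m "\<lambda>x. - g x" M] g sets by simp
  qed
  have int: "integrable m (\<lambda>x. max 0 (h x) *\<^sub>R f x)" if h: "integrable m h" for h :: "'a \<Rightarrow> real"
  proof (rule Bochner_Integration.integrable_bound)
    show "integrable m (\<lambda>x. K * h x)" using h by simp
    show "AE x in m. norm (max 0 (h x) *\<^sub>R f x) \<le> norm (K * h x)"
    proof (rule AE_I2)
      fix x assume "x \<in> space m"
      then have K: "norm (f x) \<le> K" by (rule bound)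
      then have "0 \<le> K" using norm_ge_zero order_trans by blast
      moreover have "\<bar>max 0 (h x)\<bar> * norm (f x) \<le> \<bar>h x\<bar> * K"
        using K by (intro mult_mono) auto
      ultimately show "norm (max 0 (h x) *\<^sub>R f x) \<le> norm (K * h x)"
        by (simp add: abs_mult mult.commute)
    qed
  qed (use h in measurable)
  have "signed_integral M (\<lambda>A. LINT x:A|m. g x) f =
      (LINT x|m. max 0 (g x) *\<^sub>R f x) - (LINT x|m. max 0 (- g x) *\<^sub>R f x)"
    unfolding signed_integral_def upper_variation_density[OF g sets] neg
    by (subst (1 2) integral_density) auto
  also have "\<dots> = (LINT x|m. max 0 (g x) *\<^sub>R f x - max 0 (- g x) *\<^sub>R f x)"
    using g by (intro Bochner_Integration.integral_diff[symmetric] int) auto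
  also have "\<dots> = (LINT x|m. complex_of_real (g x) * f x)"
    by (intro Bochner_Integration.integral_cong) (auto simp: max_def scaleR_conv_of_real)
  finally show ?thesis .
qed

lemma complex_measure_integral_density_measure:
  fixes f \<phi> :: "'a \<Rightarrow> complex"
  assumes f: "integrable m f" and sets: "sets m = sets M"
    and \<phi>: "\<phi> \<in> borel_measurable m" and bound: "\<And>x. x \<in> space m \<Longrightarrow> norm (\<phi> x) \<le> K"
  shows "complex_measure_integral M (density_measure m f) \<phi> = (LINT x|m. \<phi> x * f x)"
proof -
  have setint: "integrable m (\<lambda>x. indicat_real A x *\<^sub>R f x)" if "A \<in> sets m" for A
    using that f by (rule integrable_mult_indicator)
  have Re: "Re (density_measure m f A) = (LINT x:A|m. Re (f x))"
    and Im: "Im (density_measure m f A) = (LINT x:A|m. Im (f x))" if "A \<in> sets M" for A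
    using integral_Re[OF setint, of A] integral_Im[OF setint, of A] that sets
    by (simp_all add: density_measure_def set_lebesgue_integral_def)
  have si_cong: "signed_integral M \<nu> \<phi> = signed_integral M \<nu>' \<phi>"
    if "\<And>A. A \<in> sets M \<Longrightarrow> \<nu> A = \<nu>' A" for \<nu> \<nu>' :: "'a set \<Rightarrow> real"
    using that upper_variation_cong[of M \<nu> \<nu>']
      upper_variation_cong[of M "\<lambda>A. - \<nu> A" "\<lambda>A. - \<nu>' A"]
    by (simp add: signed_integral_def)
  have intR: "integrable m (\<lambda>x. complex_of_real (h x) * \<phi> x)" if "integrable m h" for h
  proof (rule Bochner_Integration.integrable_bound)
    show "integrable m (\<lambda>x. K * h x)" using that by simp
    show "(\<lambda>x. complex_of_real (h x) * \<phi> x) \<in> borel_measurable m"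
      using \<phi> that by measurable
    show "AE x in m. norm (complex_of_real (h x) * \<phi> x) \<le> norm (K * h x)"
    proof (rule AE_I2)
      fix x assume "x \<in> space m"
      then have "norm (\<phi> x) \<le> K" by (rule bound)
      then have "\<bar>h x\<bar> * norm (\<phi> x) \<le> \<bar>h x\<bar> * \<bar>K\<bar>"
        by (intro mult_left_mono) auto
      then show "norm (complex_of_real (h x) * \<phi> x) \<le> norm (K * h x)"
        by (simp add: abs_mult norm_mult mult.commute)
    qed
  qed
  have "complex_measure_integral M (density_measure m f) \<phi> =
      (LINT x|m. complex_of_real (Re (f x)) * \<phi> x) + \<i> * (LINT x|m. complex_of_real (Im (f x)) * \<phi> x)"
    unfolding complex_measure_integral_def
    using f sets \<phi> bound
    by (simp add: si_cong[OF Re] si_cong[OF Im] signed_integral_density[where K=K])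
  also have "\<dots> = (LINT x|m. complex_of_real (Re (f x)) * \<phi> x + \<i> * (complex_of_real (Im (f x)) * \<phi> x))"
    using f by (subst Bochner_Integration.integral_add) (auto intro!: intR integrable_mult_right)
  also have "\<dots> = (LINT x|m. \<phi> x * f x)"
    by (intro Bochner_Integration.integral_cong refl) (simp add: complex_eq_iff algebra_simps)
  finally show ?thesis .
qed

lemma complex_measure_density_measure:
  assumes f: "integrable m f" and sets: "sets m = sets M"
  shows "complex_measure M (density_measure m f)"
  unfolding complex_measure_def
proof (intro allI impI)
  fix A :: "nat \<Rightarrow> 'a set" assume A: "range A \<subseteq> sets M" "disjoint_family A"
  then have Am: "A i \<in> sets m" for i using sets by auto
  have setint: "set_integrable m B f" if "B \<in> sets m" for B
    using that f by (simp add: set_integrable_def integrable_mult_indicator)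
  have "(\<lambda>n. LINT x:(\<Union>i<n. A i)|m. f x) \<longlonglongrightarrow> (LINT x:(\<Union>n. \<Union>i<n. A i)|m. f x)"
    using Am by (intro set_integral_cont_up setint) (force simp: incseq_def)+
  also have "(\<Union>n. \<Union>i<n. A i) = (\<Union>i. A i)"
    by auto
  also have "(\<lambda>n. LINT x:(\<Union>i<n. A i)|m. f x) = (\<lambda>n. \<Sum>i<n. LINT x:A i|m. f x)"
    using A Am setint
    by (intro ext set_integral_finite_Union) (auto simp: disjoint_family_on_def)
  finally show "(\<lambda>i. density_measure m f (A i)) sums density_measure m f (\<Union>i. A i)"
    by (simp add: sums_def density_measure_def)
qed

section \<open>Fourier analysis on the circle\<close>

lemma measurable_circle_haar_continuous:
  fixes f :: "complex \<Rightarrow> 'b::topological_space"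
  assumes "continuous_on (sphere 0 1) f"
  shows "f \<in> borel_measurable circle_haar"
  using borel_measurable_continuous_on_restrict[OF assms] by (simp cong: measurable_cong_sets)

lemma measurable_circle_haar_borel:
  "f \<in> borel \<rightarrow>\<^sub>M N \<Longrightarrow> f \<in> circle_haar \<rightarrow>\<^sub>M N"
  unfolding measurable_cong_sets[OF sets_circle_haar refl] by (rule measurable_restrict_space1)

lemma integrable_circle_haar_continuous:
  fixes f :: "complex \<Rightarrow> 'b::{banach, second_countable_topology}"
  assumes "continuous_on (sphere 0 1) f"
  shows "integrable circle_haar f"
proof -
  interpret prob_space circle_haar by (rule prob_space_circle_haar)
  have "bounded (f ` sphere 0 1)"
    using assms by (intro compact_imp_bounded compact_continuous_image) auto
  then obtain B where "\<And>w. w \<in> sphere 0 1 \<Longrightarrow> norm (f w) \<le> B"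
    unfolding bounded_iff by blast
  then show ?thesis
    using assms by (intro integrable_const_bound[where B=B] measurable_circle_haar_continuous) auto
qed

text \<open>
  For \<open>m \<noteq> n\<close> choose a rotation \<open>c\<close> with \<open>c ^ m * cnj c ^ n = - 1\<close>: the rotation-invariant integral is
  then equal to its own negative.
\<close>
lemma circle_haar_moment:
  "(LINT w|circle_haar. w ^ m * cnj w ^ n) = of_bool (m = n)"
proof (cases "m = n")
  case True
  interpret prob_space circle_haar by (rule prob_space_circle_haar)
  have "(LINT w|circle_haar. w ^ m * cnj w ^ n) = (LINT w|circle_haar. (1::complex))"
    using True by (intro Bochner_Integration.integral_cong)
      (auto simp flip: power_mult_distrib simp: complex_norm_square[symmetric])
  then show ?thesis using True prob_space by simp
next
  case False
  \<comment> \<open>Then \<open>(m - n) t = pi\<close>.\<close>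
  define t where "t = pi / (real m - real n)"
  define c where "c = cis t"
  have c: "c ^ m * cnj c ^ n = -1"
  proof -
    have "c ^ m * cnj c ^ n = cis (real m * t + real n * (- t))"
      by (simp only: c_def cis_cnj Complex.DeMoivre cis_mult)
    also have "real m * t + real n * (- t) = pi"
      using False by (simp add: t_def divide_simps) (simp add: algebra_simps)
    finally show ?thesis by simp
  qed
  let ?f = "\<lambda>w. w ^ m * cnj w ^ n"
  have meas: "?f \<in> borel_measurable circle_haar"
    by (intro measurable_circle_haar_continuous continuous_intros)
  have rot: "(*) c \<in> circle_haar \<rightarrow>\<^sub>M circle_haar"
  proof -
    have "(*) c \<in> restrict_space borel (sphere 0 1) \<rightarrow>\<^sub>M restrict_space borel (sphere 0 1)"
      by (intro measurable_restrict_space2 measurable_restrict_space1)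
        (auto simp: space_restrict_space norm_mult c_def)
    then show ?thesis by (simp cong: measurable_cong_sets)
  qed
  have "(LINT w|circle_haar. ?f w) = (LINT w|distr circle_haar circle_haar ((*) c). ?f w)"
    by (subst circle_haar_rotate) (auto simp: c_def)
  also have "\<dots> = (LINT w|circle_haar. ?f (c * w))"
    by (rule integral_distr[OF rot meas])
  also have "\<dots> = (LINT w|circle_haar. (c ^ m * cnj c ^ n) * ?f w)"
    by (simp add: power_mult_distrib mult_ac)
  also have "\<dots> = - (LINT w|circle_haar. ?f w)"
    unfolding c by simp
  finally show ?thesis using False by simp
qed

text \<open>
  Both series converge absolutely and uniformly on the circle, so they may be integrated term by term,
  first the one in \<open>cnj w\<close> against a single power of \<open>w\<close>, then the one in \<open>w\<close>.
\<close>
lemma circle_haar_parseval: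
  fixes P Q :: "nat \<Rightarrow> complex"
  assumes P: "summable (\<lambda>n. norm (P n))" and Q: "summable (\<lambda>n. norm (Q n))"
  shows "(\<lambda>n. P n * Q n) sums (LINT w|circle_haar. (\<Sum>n. P n * w ^ n) * (\<Sum>n. Q n * cnj w ^ n))"
proof -
  interpret prob_space circle_haar by (rule prob_space_circle_haar)
  define G where "G w = (\<Sum>n. Q n * cnj w ^ n)" for w
  have normQ: "norm (Q n * cnj w ^ n) = norm (Q n)" and normP: "norm (P n * w ^ n) = norm (P n)"
    if "norm w = 1" for w n
    using that by (simp_all add: norm_mult norm_power)
  have sumQ: "summable (\<lambda>n. Q n * cnj w ^ n)" and sumP: "summable (\<lambda>n. P n * w ^ n)"
    if "norm w = 1" for w
    using P Q normP[OF that] normQ[OF that] by (auto intro: summable_norm_cancel)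
  have intn: "integrable circle_haar (\<lambda>w. w ^ m * (Q n * cnj w ^ n))" for m n
    by (intro integrable_circle_haar_continuous continuous_intros)
  have eqG: "(\<Sum>n. w ^ m * (Q n * cnj w ^ n)) = w ^ m * G w" if "norm w = 1" for w m
    unfolding G_def by (rule suminf_mult[OF sumQ[OF that]])
  have norm_n: "norm (w ^ m * (Q n * cnj w ^ n)) = norm (Q n)" if "norm w = 1" for w m n
    using that by (simp add: norm_mult norm_power)
  have int_norm: "(LINT w|circle_haar. norm (w ^ m * (Q n * cnj w ^ n))) = norm (Q n)" for m n
  proof -
    have "(LINT w|circle_haar. norm (w ^ m * (Q n * cnj w ^ n))) = (LINT w|circle_haar. norm (Q n))"
      by (intro Bochner_Integration.integral_cong refl) (simp add: norm_n)
    then show ?thesis using prob_space by simp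
  qed
  have ae: "AE w in circle_haar. summable (\<lambda>n. norm (w ^ m * (Q n * cnj w ^ n)))" for m
    by (intro AE_I2) (simp add: norm_n Q)
  have sm: "summable (\<lambda>n. LINT w|circle_haar. norm (w ^ m * (Q n * cnj w ^ n)))" for m
    unfolding int_norm by (rule Q)
  have intG: "integrable circle_haar (\<lambda>w. w ^ m * G w)" for m
  proof -
    have "integrable circle_haar (\<lambda>w. \<Sum>n. w ^ m * (Q n * cnj w ^ n))"
      by (rule integrable_suminf[OF intn ae sm])
    then show ?thesis
      by (rule Bochner_Integration.integrable_cong[THEN iffD1, rotated 2]) (auto simp: eqG)
  qed
  have momG: "(LINT w|circle_haar. w ^ m * G w) = Q m" for m
  proof -
    have "(LINT w|circle_haar. w ^ m * G w) = (LINT w|circle_haar. (\<Sum>n. w ^ m * (Q n * cnj w ^ n)))"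
      by (intro Bochner_Integration.integral_cong refl) (simp add: eqG)
    also have "\<dots> = (\<Sum>n. LINT w|circle_haar. w ^ m * (Q n * cnj w ^ n))"
      by (rule integral_suminf[OF intn ae sm])
    also have "\<dots> = (\<Sum>n. Q n * of_bool (m = n))"
      by (simp add: circle_haar_moment[symmetric] mult.left_commute del: of_bool_eq_iff)
    also have "\<dots> = (\<Sum>n\<in>{m}. Q n * of_bool (m = n))"
      by (rule suminf_finite) auto
    finally show ?thesis by simp
  qed
  define S where "S = (\<Sum>n. norm (Q n))"
  have normG: "norm (G w) \<le> S" if "norm w = 1" for w
    unfolding G_def S_def using summable_norm[of "\<lambda>n. Q n * cnj w ^ n"] Q normQ[OF that] by simp
  have intm: "integrable circle_haar (\<lambda>w. P m * (w ^ m * G w))" for m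
    by (intro integrable_mult_right intG)
  have norm_m: "norm (P m * (w ^ m * G w)) \<le> norm (P m) * S" if "norm w = 1" for w m
    using that normG[OF that] by (simp add: norm_mult norm_power mult_left_mono)
  have "(\<lambda>m. LINT w|circle_haar. P m * (w ^ m * G w)) sums
      (LINT w|circle_haar. (\<Sum>m. P m * (w ^ m * G w)))"
  proof (rule sums_integral[OF intm])
    show "AE w in circle_haar. summable (\<lambda>m. norm (P m * (w ^ m * G w)))"
    proof (rule AE_I2)
      fix w :: complex assume "w \<in> space circle_haar"
      then show "summable (\<lambda>m. norm (P m * (w ^ m * G w)))"
        using norm_m P by (intro summable_comparison_test'[OF summable_mult2[OF P, of S], where N=0]) auto
    qed
    show "summable (\<lambda>m. LINT w|circle_haar. norm (P m * (w ^ m * G w)))"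
    proof (rule summable_comparison_test'[OF summable_mult2[OF P, of S], where N=0])
      fix m
      have "(LINT w|circle_haar. norm (P m * (w ^ m * G w))) \<le> (LINT w|circle_haar. norm (P m) * S)"
        using norm_m intm by (intro integral_mono integrable_norm) auto
      then show "norm (LINT w|circle_haar. norm (P m * (w ^ m * G w))) \<le> norm (P m) * S"
        using prob_space by simp
    qed
  qed
  also have "(LINT w|circle_haar. (\<Sum>m. P m * (w ^ m * G w))) =
      (LINT w|circle_haar. (\<Sum>n. P n * w ^ n) * G w)"
    by (intro Bochner_Integration.integral_cong refl)
      (simp add: suminf_mult2[OF sumP] mult.assoc)
  finally show ?thesis
    unfolding integral_mult_right_zero momG unfolding G_def .
qed

lemma binomial_series_pochhammer:
  fixes p z :: complex
  assumes "norm z < 1"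
  shows "(\<lambda>n. pochhammer p n / fact n * z ^ n) sums (1 - z) powr (- p)"
proof -
  have "(\<lambda>n. ((- p) gchoose n) * (- z) ^ n) sums (1 + (- z)) powr (- p)"
    using assms by (intro gen_binomial_complex) simp
  moreover have "((- p) gchoose n) * (- z) ^ n = pochhammer p n / fact n * z ^ n" for n
  proof -
    have "(- 1) ^ n * (- z) ^ n = z ^ n"
      by (simp flip: power_mult_distrib)
    then show ?thesis
      by (simp add: gbinomial_pochhammer)
  qed
  ultimately show ?thesis by simp
qed

text \<open>
  The value is \<open>\<^sub>2F\<^sub>1(p, q; 1; r\<^sup>2)\<close>, obtained by expanding both powers into binomial series.
\<close>
lemma circle_integral_binomial:
  fixes p q :: complex and r :: real
  assumes r: "0 \<le> r" "r < 1"
  shows "(\<lambda>n. (pochhammer p n / fact n) * (pochhammer q n / fact n) * complex_of_real (r\<^sup>2) ^ n) sums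
    (LINT w|circle_haar. (1 - complex_of_real r * w) powr (- p) *
       (1 - complex_of_real r * cnj w) powr (- q))"
proof -
  have summ: "summable (\<lambda>n. norm (pochhammer p n / fact n * complex_of_real r ^ n))" for p :: complex
  proof (rule powser_insidea)
    \<comment> \<open>Convergence at a point of the disc of larger modulus than \<open>r\<close> gives absolute convergence at \<open>r\<close>.\<close>
    show "summable (\<lambda>n. pochhammer p n / fact n * complex_of_real ((1 + r) / 2) ^ n)"
    proof (intro sums_summable[OF binomial_series_pochhammer])
      show "norm (complex_of_real ((1 + r) / 2)) < 1"
        using r by (simp only: norm_of_real) simp
    qed
    show "norm (complex_of_real r) < norm (complex_of_real ((1 + r) / 2))"
      using r by (simp only: norm_of_real) simp
  qed
  have eq: "(\<Sum>n. pochhammer p n / fact n * complex_of_real r ^ n * w ^ n) =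
      (1 - complex_of_real r * w) powr (- p)" if "norm w = 1" for p w
    using binomial_series_pochhammer[of "complex_of_real r * w" p] r that
    by (simp add: norm_mult power_mult_distrib mult.assoc sums_iff)
  have "(LINT w|circle_haar. (\<Sum>n. pochhammer p n / fact n * complex_of_real r ^ n * w ^ n) *
      (\<Sum>n. pochhammer q n / fact n * complex_of_real r ^ n * cnj w ^ n)) =
     (LINT w|circle_haar. (1 - complex_of_real r * w) powr (- p) *
       (1 - complex_of_real r * cnj w) powr (- q))"
    by (intro Bochner_Integration.integral_cong refl)
      (simp only: space_circle_haar mem_sphere_0 eq complex_mod_cnj)
  then show ?thesis
    using circle_haar_parseval[OF summ[of p] summ[of q]]
    by (simp add: power2_eq_square power_mult_distrib mult_ac)
qed

section \<open>An Abelian theorem\<close>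

text \<open>
  This is Euler's limit for the Gamma function, read as \<open>(z)\<^sub>n / n! \<sim> n\<^bsup>z-1\<^esup> / \<Gamma>(z)\<close>.
\<close>
lemma pochhammer_over_fact_asymptotics:
  fixes z :: "'a::Gamma"
  assumes z: "z \<notin> \<int>\<^sub>\<le>\<^sub>0"
  shows "(\<lambda>n. pochhammer z n / fact n * exp ((1 - z) * of_real (ln (of_nat n)))) \<longlonglongrightarrow> inverse (Gamma z)"
proof -
  have "(\<lambda>n. inverse (Gamma_series' z n)) \<longlonglongrightarrow> inverse (Gamma z)"
    using z by (intro tendsto_inverse Gamma_series'_LIMSEQ) (simp add: Gamma_eq_zero_iff)
  moreover have "\<forall>\<^sub>F n in sequentially. inverse (Gamma_series' z n) =
      pochhammer z n / fact n * exp ((1 - z) * of_real (ln (of_nat n)))"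
    using eventually_gt_at_top[of 0]
  proof eventually_elim
    case (elim n)
    have "fact n = of_nat n * (fact (n - 1) :: 'a)"
      using elim by (simp add: fact_reduce)
    moreover have "exp (of_real (ln (of_nat n)) :: 'a) = of_nat n"
      using elim by (simp add: exp_of_real)
    moreover have "(1 - z) * of_real (ln (of_nat n)) =
        of_real (ln (of_nat n)) - z * of_real (ln (of_nat n))"
      by (simp add: algebra_simps)
    ultimately show ?case
      using elim by (simp add: Gamma_series'_def exp_diff field_simps)
  qed
  ultimately show ?thesis
    by (rule Lim_transform_eventually)
qed

text \<open>
  Both \<open>(p)\<^sub>n (q)\<^sub>n / n!\<^sup>2\<close> and \<open>(p+q-1)\<^sub>n / n!\<close> grow like \<open>n\<^bsup>p+q-2\<^esup>\<close>, with leading constants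
  \<open>1 / (\<Gamma>(p) \<Gamma>(q))\<close> and \<open>1 / \<Gamma>(p+q-1)\<close>; the factor \<open>L\<close> matches them. The real sequence
  \<open>(s)\<^sub>n / n!\<close> measures the common order of magnitude \<open>n\<^bsup>s-1\<^esup>\<close>.
\<close>
lemma pochhammer_product_asymptotics:
  fixes p q :: complex
  assumes p: "p \<notin> \<int>\<^sub>\<le>\<^sub>0" and q: "q \<notin> \<int>\<^sub>\<le>\<^sub>0" and pos: "Re p + Re q > 1"
  defines "L \<equiv> Gamma (p + q - 1) / (Gamma p * Gamma q)"
    and "s \<equiv> Re p + Re q - 1"
  shows "(\<lambda>n. norm ((pochhammer p n / fact n) * (pochhammer q n / fact n) -
            L * (pochhammer (p + q - 1) n / fact n)) / (pochhammer s n / fact n)) \<longlonglongrightarrow> 0"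
proof -
  define R where "R z n = pochhammer z n / fact n * exp ((1 - z) * of_real (ln (of_nat n)))"
    for z :: complex and n
  define R' where "R' n = pochhammer s n / fact n * exp ((1 - s) * ln (of_nat n))" for n
  have pq: "p + q - 1 \<notin> \<int>\<^sub>\<le>\<^sub>0"
    using pos by (auto elim!: nonpos_Ints_cases simp: complex_eq_iff)
  have s: "s > 0" "s \<notin> \<int>\<^sub>\<le>\<^sub>0"
    using pos by (auto elim!: nonpos_Ints_cases simp: s_def)
  have R: "R z \<longlonglongrightarrow> inverse (Gamma z)" if "z \<notin> \<int>\<^sub>\<le>\<^sub>0" for z
    using pochhammer_over_fact_asymptotics[OF that] by (simp add: R_def[abs_def])
  have R': "R' \<longlonglongrightarrow> inverse (Gamma s)"
    using pochhammer_over_fact_asymptotics[OF s(2)] by (simp add: R'_def[abs_def])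
  have Gs: "inverse (Gamma s) \<noteq> 0" "Gamma (p + q - 1) \<noteq> 0"
    using s pq by (simp_all add: Gamma_eq_zero_iff)
  have "(\<lambda>n. norm (R p n * R q n - L * R (p + q - 1) n) / R' n) \<longlonglongrightarrow>
      norm (inverse (Gamma p) * inverse (Gamma q) - L * inverse (Gamma (p + q - 1))) / inverse (Gamma s)"
    using p q pq Gs(1) by (intro tendsto_intros R R')
  also have "inverse (Gamma p) * inverse (Gamma q) - L * inverse (Gamma (p + q - 1)) = 0"
    using Gs(2) by (simp add: L_def field_simps)
  finally have lim: "(\<lambda>n. norm (R p n * R q n - L * R (p + q - 1) n) / R' n) \<longlonglongrightarrow> 0"
    by simp
  have "norm (R p n * R q n - L * R (p + q - 1) n) / R' n =
      norm ((pochhammer p n / fact n) * (pochhammer q n / fact n) -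
            L * (pochhammer (p + q - 1) n / fact n)) / (pochhammer s n / fact n)" for n
  proof -
    define l where "l = ln (real n)"
    define E where "E = exp ((2 - p - q) * complex_of_real l)"
    have nE: "norm E = exp ((1 - s) * l)"
      by (simp add: E_def s_def norm_exp_eq_Re)
    have E: "exp ((1 - p) * complex_of_real l) * exp ((1 - q) * complex_of_real l) = E"
        "exp ((1 - (p + q - 1)) * complex_of_real l) = E"
      by (auto simp: E_def algebra_simps simp flip: exp_add)
    have Rpq: "R p n * R q n = (pochhammer p n / fact n) * (pochhammer q n / fact n) * E"
      unfolding E(1)[symmetric] R_def l_def by (simp only: mult_ac)
    have Rs: "R (p + q - 1) n = pochhammer (p + q - 1) n / fact n * E"
      unfolding E(2)[symmetric] R_def l_def by (rule refl)
    have "R p n * R q n - L * R (p + q - 1) n = ((pochhammer p n / fact n) * (pochhammer q n / fact n) -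
            L * (pochhammer (p + q - 1) n / fact n)) * E"
      by (simp only: Rpq Rs left_diff_distrib mult.assoc)
    moreover have "R' n = pochhammer s n / fact n * exp ((1 - s) * l)"
      by (simp add: R'_def l_def)
    ultimately show ?thesis
      by (simp add: norm_mult nE)
  qed
  then show ?thesis using lim by simp
qed

lemma eventually_at_1_within:
  "\<forall>\<^sub>F x::real in at 1 within {0..<1}. 0 \<le> x \<and> x < 1"
  by (auto simp: eventually_at_filter)

text \<open>
  The coefficients \<open>(s)\<^sub>n / n!\<close> are those of \<open>(1 - x) powr (- s)\<close>, which blows up at 1. Coefficients of
  smaller order therefore give a sum of smaller order: beyond some index they contribute at most a
  small multiple of that blow-up, and the finitely many earlier terms stay bounded.
\<close>
lemma abel_comparison:
  fixes D :: "nat \<Rightarrow> complex"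
  assumes s: "s > 0" and D: "(\<lambda>n. norm (D n) / (pochhammer s n / fact n)) \<longlonglongrightarrow> 0"
  shows "((\<lambda>x. (1 - x) powr s * norm (\<Sum>n. D n * of_real x ^ n)) \<longlongrightarrow> 0) (at 1 within {0..<1})"
proof (rule tendstoI)
  fix e :: real assume e: "e > 0"
  have pos: "pochhammer s n / fact n > 0" for n
    using s by (simp add: pochhammer_pos)
  have "\<forall>\<^sub>F n in sequentially. norm (D n) / (pochhammer s n / fact n) < e / 2"
    using D e by (auto dest!: order_tendstoD(2)[of _ _ _ "e / 2"])
  then obtain N where N: "\<And>n. n \<ge> N \<Longrightarrow> norm (D n) / (pochhammer s n / fact n) < e / 2"
    unfolding eventually_sequentially by blast
  have DN: "norm (D n) \<le> e / 2 * (pochhammer s n / fact n)" if "n \<ge> N" for n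
    using N[OF that] pos[of n] by (simp only: pos_divide_less_eq less_imp_le)
  define K where "K = (\<Sum>n<N. norm (D n))"
  have bound: "(1 - x) powr s * norm (\<Sum>n. D n * of_real x ^ n) \<le> K * (1 - x) powr s + e / 2"
    if x: "0 \<le> x" "x < 1" for x
  proof -
    have "(\<lambda>n. complex_of_real (pochhammer s n / fact n * x ^ n)) sums
        complex_of_real ((1 - x) powr (- s))"
      using binomial_series_pochhammer[of "complex_of_real x" "complex_of_real s"] x
        powr_of_real[of "1 - x" "- s"]
      by (simp add: pochhammer_of_real)
    then have "(\<lambda>n. pochhammer s n / fact n * x ^ n) sums (1 - x) powr (- s)"
      by (simp only: sums_of_real_iff)
    then have sums: "(\<lambda>n. (if n < N then norm (D n) else 0) + e / 2 * (pochhammer s n / fact n * x ^ n))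
        sums (K + e / 2 * (1 - x) powr (- s))"
      unfolding K_def using sums_If_finite_set[of "{..<N}" "\<lambda>n. norm (D n)"]
      by (intro sums_add sums_mult) auto
    have "norm (\<Sum>n. D n * of_real x ^ n) \<le>
        (\<Sum>n. (if n < N then norm (D n) else 0) + e / 2 * (pochhammer s n / fact n * x ^ n))"
    proof (intro norm_suminf_le sums_summable[OF sums])
      fix n
      have xn: "0 \<le> x ^ n" "x ^ n \<le> 1" using x by (auto intro: power_le_one)
      have nn: "0 \<le> e / 2 * (pochhammer s n / fact n * x ^ n)"
        using e pos[of n] xn by (intro mult_nonneg_nonneg) auto
      show "norm (D n * of_real x ^ n) \<le>
          (if n < N then norm (D n) else 0) + e / 2 * (pochhammer s n / fact n * x ^ n)"
      proof (cases "n < N")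
        case True
        have "norm (D n * of_real x ^ n) \<le> norm (D n) * 1"
          using xn x by (simp add: norm_mult norm_power mult_left_le)
        then show ?thesis using True nn by simp
      next
        case False
        have "norm (D n * of_real x ^ n) = norm (D n) * x ^ n"
          using x by (simp add: norm_mult norm_power)
        also have "\<dots> \<le> e / 2 * (pochhammer s n / fact n) * x ^ n"
          using False xn by (intro mult_right_mono DN) auto
        finally show ?thesis using False by (simp add: mult.assoc)
      qed
    qed
    also have "\<dots> = K + e / 2 * (1 - x) powr (- s)"
      using sums by (rule sums_unique[symmetric])
    finally have "(1 - x) powr s * norm (\<Sum>n. D n * of_real x ^ n) \<le>
        (1 - x) powr s * (K + e / 2 * (1 - x) powr (- s))"
      by (intro mult_left_mono) auto
    also have "\<dots> = K * (1 - x) powr s + e / 2 * ((1 - x) powr s * (1 - x) powr (- s))"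
      by (simp add: algebra_simps)
    also have "(1 - x) powr s * (1 - x) powr (- s) = 1"
      using x by (simp flip: powr_add)
    finally show ?thesis by simp
  qed
  have "((\<lambda>x. K * (1 - x) powr s) \<longlongrightarrow> K * 0) (at 1 within {0..<1})"
  proof (intro tendsto_mult tendsto_const)
    have "((\<lambda>x. (1 - x) powr s) \<longlongrightarrow> 0 powr s) (at 1 within {0..<1})"
      by (intro tendsto_powr' tendsto_const)
        (use s in \<open>auto intro!: tendsto_eq_intros eventually_mono[OF eventually_at_1_within]\<close>)
    then show "((\<lambda>x. (1 - x) powr s) \<longlongrightarrow> 0) (at 1 within {0..<1})"
      by simp
  qed
  then have "\<forall>\<^sub>F x in at 1 within {0..<1}. K * (1 - x) powr s < e / 2"
    using e by (auto dest!: order_tendstoD(2)[of _ _ _ "e / 2"])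
  then show "\<forall>\<^sub>F x in at 1 within {0..<1}. dist ((1 - x) powr s * norm (\<Sum>n. D n * of_real x ^ n)) 0 < e"
    using eventually_at_1_within
  proof eventually_elim
    case (elim x)
    then show ?case using bound[of x] by simp
  qed
qed

section \<open>The one-dimensional kernel\<close>

text \<open>
  The one-dimensional kernel without its constant. With \<open>z = r \<zeta>\<close> and \<open>w = \<zeta> * cnj \<eta>\<close>, it is the value at
  \<open>(z, \<eta>)\<close>, which depends on \<open>\<zeta>\<close> and \<open>\<eta>\<close> through \<open>w\<close> alone.
\<close>
definition poisson_factor :: "complex \<Rightarrow> complex \<Rightarrow> real \<Rightarrow> complex \<Rightarrow> complex" where
  "poisson_factor a b r w = complex_of_real (1 - r\<^sup>2) powr (a + b + 1) /
     ((1 - complex_of_real r * w) powr (a + 1) * (1 - complex_of_real r * cnj w) powr (b + 1))"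

text \<open>
  On the circle this positive kernel dominates, up to a constant, every factor with
  \<open>Re a + Re b + 1 = s\<close>, and is itself the factor with \<open>a = b = (s - 1) / 2\<close>. The
  total mass of the majorant is thus controlled by the same computation that gives the integral of
  the kernel.
\<close>
definition radial_majorant :: "real \<Rightarrow> real \<Rightarrow> complex \<Rightarrow> real" where
  "radial_majorant s r w = (1 - r\<^sup>2) powr s / norm (1 - complex_of_real r * w) powr (s + 1)"

lemma Re_one_minus_pos:
  assumes "0 \<le> r" "r < 1" "norm w \<le> 1"
  shows "Re (1 - complex_of_real r * w) > 0"
proof -
  have "norm (complex_of_real r * w) < 1"
    using assms mult_left_mono[of "norm w" 1 r] by (simp add: norm_mult)
  then show ?thesis
    using complex_Re_le_cmod[of "complex_of_real r * w"] by simp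
qed

lemma norm_one_minus_cnj: "norm (1 - complex_of_real r * cnj w) = norm (1 - complex_of_real r * w)"
  using complex_mod_cnj[of "1 - complex_of_real r * w"] by simp

lemma continuous_on_poisson_factor:
  assumes r: "0 \<le> r" "r < 1"
  shows "continuous_on (sphere 0 1) (poisson_factor a b r)"
proof -
  have pos: "Re (1 - complex_of_real r * w) > 0" "Re (1 - complex_of_real r * cnj w) > 0"
    if "w \<in> sphere 0 1" for w
    using that r by (auto intro!: Re_one_minus_pos simp del: minus_complex.sel)
  then have "1 - complex_of_real r * w \<noteq> 0" "1 - complex_of_real r * cnj w \<noteq> 0"
    if "w \<in> sphere 0 1" for w
    using that by fastforce+
  then show ?thesis
    unfolding poisson_factor_def using pos
    by (intro continuous_intros) (auto simp: less_imp_le)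
qed

lemma continuous_on_radial_majorant:
  assumes r: "0 \<le> r" "r < 1"
  shows "continuous_on (sphere 0 1) (radial_majorant s r)"
proof -
  have "1 - complex_of_real r * w \<noteq> 0" if "w \<in> sphere 0 1" for w
    using Re_one_minus_pos[OF r, of w] that by fastforce
  then show ?thesis
    unfolding radial_majorant_def by (intro continuous_intros) auto
qed

lemma radial_majorant_nonneg: "radial_majorant s r w \<ge> 0"
  by (simp add: radial_majorant_def)

text \<open>
  With \<open>x = r\<^sup>2\<close>, the integral equals \<open>(1 - x) powr (a + b + 1) * (\<Sum>n. A n * x ^ n)\<close>. The coefficients
  \<open>A n\<close> are, up to lower order, \<open>L\<close> times the coefficients \<open>B n\<close> of \<open>(1 - x) powr (- (a + b + 1))\<close>, and the
  Abelian comparison shows that the error disappears in the limit. This replaces Gauss's evaluation of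
  \<open>\<^sub>2F\<^sub>1(- a, - b; 1; 1)\<close>.
\<close>
lemma tendsto_poisson_factor_integral:
  assumes a: "a + 1 \<notin> \<int>\<^sub>\<le>\<^sub>0" and b: "b + 1 \<notin> \<int>\<^sub>\<le>\<^sub>0" and pos: "Re a + Re b > -1"
  shows "((\<lambda>r. LINT w|circle_haar. poisson_factor a b r w) \<longlongrightarrow>
    Gamma (a + b + 1) / (Gamma (a + 1) * Gamma (b + 1))) (at 1 within {0..<1})"
proof -
  define s where "s = Re a + Re b + 1"
  define L where "L = Gamma (a + b + 1) / (Gamma (a + 1) * Gamma (b + 1))"
  define A where "A n = (pochhammer (a + 1) n / fact n) * (pochhammer (b + 1) n / fact n)" for n
  define B where "B n = pochhammer (a + b + 1) n / fact n" for n
  define D where "D n = A n - L * B n" for n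
  have "(\<lambda>n. norm (D n) / (pochhammer s n / fact n)) \<longlonglongrightarrow> 0"
    using pochhammer_product_asymptotics[OF a b] pos
    by (simp add: D_def A_def B_def L_def s_def algebra_simps)
  then have abel: "((\<lambda>x. (1 - x) powr s * norm (\<Sum>n. D n * of_real x ^ n)) \<longlongrightarrow> 0) (at 1 within {0..<1})"
    using pos by (intro abel_comparison) (simp_all add: s_def)
  have "filterlim (\<lambda>r::real. r\<^sup>2) (at 1 within {0..<1}) (at 1 within {0..<1})"
    unfolding filterlim_at
  proof
    show "\<forall>\<^sub>F r::real in at 1 within {0..<1}. r\<^sup>2 \<in> {0..<1} \<and> r\<^sup>2 \<noteq> 1"
      using eventually_at_1_within
      by eventually_elim (auto simp: power2_eq_1_iff power_less_one_iff abs_square_less_1)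
  qed (auto intro!: tendsto_eq_intros)
  from filterlim_compose[OF abel this]
  have abel2: "((\<lambda>r. (1 - r\<^sup>2) powr s * norm (\<Sum>n. D n * of_real (r\<^sup>2) ^ n)) \<longlongrightarrow> 0) (at 1 within {0..<1})" .
  have eq: "norm ((LINT w|circle_haar. poisson_factor a b r w) - L) =
      (1 - r\<^sup>2) powr s * norm (\<Sum>n. D n * of_real (r\<^sup>2) ^ n)" if r: "0 \<le> r" "r < 1" for r
  proof -
    define x where "x = r\<^sup>2"
    have x: "0 \<le> x" "x < 1" using r by (auto simp: x_def power_less_one_iff abs_square_less_1)
    define E where "E = complex_of_real (1 - x) powr (a + b + 1)"
    have E: "norm E = (1 - x) powr s" "E \<noteq> 0"
      using x by (simp_all add: E_def s_def norm_powr_real_powr)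
    define J where "J = (LINT w|circle_haar. (1 - complex_of_real r * w) powr (- (a + 1)) *
       (1 - complex_of_real r * cnj w) powr (- (b + 1)))"
    have "(\<lambda>n. A n * complex_of_real x ^ n) sums J"
      unfolding A_def J_def x_def using r by (rule circle_integral_binomial)
    moreover have "(\<lambda>n. B n * complex_of_real x ^ n) sums inverse E"
      using binomial_series_pochhammer[of "complex_of_real x" "a + b + 1"] x
      unfolding E_def B_def powr_minus of_real_diff by simp
    ultimately have "(\<lambda>n. A n * complex_of_real x ^ n - L * (B n * complex_of_real x ^ n)) sums
        (J - L * inverse E)"
      by (intro sums_diff sums_mult)
    then have D: "(\<Sum>n. D n * of_real x ^ n) = J - L * inverse E"
      by (simp add: D_def left_diff_distrib mult.assoc sums_iff)
    have "poisson_factor a b r w = E * ((1 - complex_of_real r * w) powr (- (a + 1)) *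
       (1 - complex_of_real r * cnj w) powr (- (b + 1)))" for w
      by (simp only: poisson_factor_def E_def x_def powr_minus divide_inverse inverse_mult_distrib)
    then have "(LINT w|circle_haar. poisson_factor a b r w) = E * J"
      unfolding J_def by (simp only: integral_mult_right_zero)
    then have "(LINT w|circle_haar. poisson_factor a b r w) - L = E * (J - L * inverse E)"
      using E(2) by (simp add: field_simps)
    then show ?thesis
      by (simp add: norm_mult E(1) flip: D x_def)
  qed
  have "((\<lambda>r. norm ((LINT w|circle_haar. poisson_factor a b r w) - L)) \<longlongrightarrow> 0) (at 1 within {0..<1})"
    by (rule Lim_transform_eventually[OF abel2])
      (use eventually_at_1_within in \<open>eventually_elim, simp add: eq\<close>)
  then show ?thesis
    unfolding L_def by (simp add: tendsto_norm_zero_iff LIM_zero_iff)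
qed

text \<open>
  On the circle the two bases \<open>1 - r w\<close> and \<open>1 - r * cnj w\<close> are conjugate, so equal real powers of them
  multiply to a power of the modulus.
\<close>
lemma radial_majorant_conv_poisson_factor:
  assumes r: "0 \<le> r" "r < 1" and w: "norm w = 1"
  defines "a s \<equiv> complex_of_real ((s - 1) / 2)"
  shows "poisson_factor (a s) (a s) r w = complex_of_real (radial_majorant s r w)"
proof -
  define z where "z = 1 - complex_of_real r * w"
  have z: "Re z > 0" using Re_one_minus_pos[OF r, of w] w by (simp add: z_def)
  define t where "t = (s + 1) / 2"
  have a: "a s + 1 = complex_of_real t" "a s + a s + 1 = complex_of_real s"
    by (simp_all add: a_def t_def field_simps)
  have "cnj z = 1 - complex_of_real r * cnj w" by (simp add: z_def)
  moreover have "cnj z powr complex_of_real t = cnj (z powr complex_of_real t)"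
    using z by (subst cnj_powr) auto
  moreover have "z powr complex_of_real t * cnj (z powr complex_of_real t) =
      complex_of_real (norm z powr (s + 1))"
  proof -
    have "norm (z powr complex_of_real t) = norm z powr t"
      by (simp add: norm_powr_real_powr')
    then have "(norm (z powr complex_of_real t))\<^sup>2 = norm z powr (s + 1)"
      by (simp add: power2_eq_square t_def flip: powr_add)
    then show ?thesis by (metis complex_norm_square of_real_power)
  qed
  moreover have "complex_of_real (1 - r\<^sup>2) powr complex_of_real s = complex_of_real ((1 - r\<^sup>2) powr s)"
    using r by (intro powr_of_real) (simp add: power_le_one)
  ultimately show ?thesis
    unfolding poisson_factor_def radial_majorant_def a by (simp add: z_def[symmetric])
qed

lemma convergent_radial_majorant_integral:
  assumes s: "s > 0"
  shows "\<exists>l. ((\<lambda>r. LINT w|circle_haar. radial_majorant s r w) \<longlongrightarrow> l) (at 1 within {0..<1})"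
proof -
  define a where "a = complex_of_real ((s - 1) / 2)"
  have a: "a + 1 \<notin> \<int>\<^sub>\<le>\<^sub>0"
  proof
    assume "a + 1 \<in> \<int>\<^sub>\<le>\<^sub>0"
    then obtain n where "a + 1 = of_int n" "n \<le> 0" by (rule nonpos_Ints_cases)
    then have "Re (a + 1) \<le> 0" by (simp only: complex_Re_of_int of_int_le_0_iff)
    moreover have "Re (a + 1) = (s + 1) / 2" by (simp add: a_def field_simps)
    ultimately show False using s by simp
  qed
  obtain l where l: "((\<lambda>r. LINT w|circle_haar. poisson_factor a a r w) \<longlongrightarrow> l) (at 1 within {0..<1})"
    using tendsto_poisson_factor_integral[OF a a] s by (force simp: a_def)
  have "\<forall>\<^sub>F r in at 1 within {0..<1}. Re (LINT w|circle_haar. poisson_factor a a r w) =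
      (LINT w|circle_haar. radial_majorant s r w)"
    using eventually_at_1_within
  proof eventually_elim
    case (elim r)
    have "(LINT w|circle_haar. poisson_factor a a r w) =
        (LINT w|circle_haar. complex_of_real (radial_majorant s r w))"
      unfolding a_def using elim
      by (intro Bochner_Integration.integral_cong refl radial_majorant_conv_poisson_factor) auto
    then show ?case by simp
  qed
  with tendsto_Re[OF l] show ?thesis
    by (blast intro: Lim_transform_eventually)
qed

text \<open>
  A complex power \<open>z powr c\<close> differs in modulus from \<open>norm z powr Re c\<close> by the factor
  \<open>exp (- Im c * Arg z)\<close>, which is at least \<open>exp (- pi * \<bar>Im c\<bar>)\<close>.
\<close>
lemma norm_poisson_factor_le:
  assumes r: "0 \<le> r" "r < 1" and w: "norm w = 1"
  shows "norm (poisson_factor a b r w) \<le>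
    exp (pi * (\<bar>Im a\<bar> + \<bar>Im b\<bar>)) * radial_majorant (Re a + Re b + 1) r w"
proof -
  define N where "N = norm (1 - complex_of_real r * w)"
  have N: "N > 0"
    using Re_one_minus_pos[OF r, of w] w unfolding N_def by (intro zero_less_norm_iff[THEN iffD2]) force
  have nz: "complex_of_real r * w \<noteq> 1" "complex_of_real r * cnj w \<noteq> 1"
    using N norm_one_minus_cnj[of r w] by (auto simp: N_def)
  have lower: "norm (z powr (c + 1)) \<ge> norm z powr (Re c + 1) * exp (- pi * \<bar>Im c\<bar>)" for z c :: complex
  proof -
    have "\<bar>Arg z\<bar> \<le> pi" using mpi_less_Arg[of z] Arg_le_pi[of z] by linarith
    then have "\<bar>Im c * Arg z\<bar> \<le> pi * \<bar>Im c\<bar>"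
      by (simp add: abs_mult mult.commute mult_right_mono)
    then show ?thesis
      by (auto simp: norm_powr_complex intro!: mult_left_mono)
  qed
  have "norm (poisson_factor a b r w) = (1 - r\<^sup>2) powr (Re a + Re b + 1) /
      (norm ((1 - complex_of_real r * w) powr (a + 1)) * norm ((1 - complex_of_real r * cnj w) powr (b + 1)))"
    using r by (simp add: poisson_factor_def norm_divide norm_mult norm_powr_real_powr power_le_one
        del: of_real_diff)
  also have "\<dots> \<le> (1 - r\<^sup>2) powr (Re a + Re b + 1) /
      ((N powr (Re a + 1) * exp (- pi * \<bar>Im a\<bar>)) * (N powr (Re b + 1) * exp (- pi * \<bar>Im b\<bar>)))"
    using lower[of "1 - complex_of_real r * w" a] lower[of "1 - complex_of_real r * cnj w" b] N nz
    unfolding norm_one_minus_cnj N_def[symmetric]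
    by (intro divide_left_mono mult_mono mult_pos_pos) auto
  also have "(N powr (Re a + 1) * exp (- pi * \<bar>Im a\<bar>)) * (N powr (Re b + 1) * exp (- pi * \<bar>Im b\<bar>)) =
      N powr (Re a + Re b + 1 + 1) * inverse (exp (pi * (\<bar>Im a\<bar> + \<bar>Im b\<bar>)))"
  proof -
    have "N powr (Re a + Re b + 1 + 1) = N powr (Re a + 1) * N powr (Re b + 1)"
      by (simp add: add_ac flip: powr_add)
    moreover have "inverse (exp (pi * (\<bar>Im a\<bar> + \<bar>Im b\<bar>))) = exp (- pi * \<bar>Im a\<bar>) * exp (- pi * \<bar>Im b\<bar>)"
      by (simp add: distrib_left flip: exp_minus exp_add)
    ultimately show ?thesis by simp
  qed
  finally show ?thesis
    by (simp add: radial_majorant_def N_def field_simps)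
qed

text \<open>
  At distance at least \<open>\<delta>\<close> from 1 the denominator stays away from 0, because
  \<open>norm (1 - w) \<le> norm (1 - r w) + (1 - r) \<le> 2 * norm (1 - r w)\<close>, while the numerator
  \<open>(1 - r\<^sup>2) powr s\<close> tends to 0.
\<close>
lemma tendsto_radial_majorant_tail:
  assumes s: "s > 0" and d: "\<delta> > 0"
  shows "((\<lambda>r. LINT w|circle_haar. indicator {w. dist w 1 \<ge> \<delta>} w * radial_majorant s r w) \<longlongrightarrow> 0)
    (at 1 within {0..<1})"
proof (rule tendsto_sandwich)
  interpret prob_space circle_haar by (rule prob_space_circle_haar)
  show "\<forall>\<^sub>F r in at 1 within {0..<1}.
      (LINT w|circle_haar. indicator {w. dist w 1 \<ge> \<delta>} w * radial_majorant s r w) \<le>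
      (1 - r\<^sup>2) powr s / (\<delta> / 2) powr (s + 1)"
    using eventually_at_1_within
  proof eventually_elim
    case (elim r)
    have "indicator {w. dist w 1 \<ge> \<delta>} w * radial_majorant s r w \<le>
        (1 - r\<^sup>2) powr s / (\<delta> / 2) powr (s + 1)" if w: "norm w = 1" for w
    proof (cases "dist w 1 \<ge> \<delta>")
      case True
      define z where "z = 1 - complex_of_real r * w"
      have "Re z \<ge> 1 - r"
        using complex_Re_le_cmod[of "complex_of_real r * w"] w elim by (simp add: z_def norm_mult)
      then have 1: "norm z \<ge> 1 - r"
        using complex_Re_le_cmod[of z] by linarith
      have "1 - w = z - complex_of_real (1 - r) * w" by (simp add: z_def algebra_simps)
      then have "norm (1 - w) \<le> norm z + norm (complex_of_real (1 - r) * w)"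
        using norm_triangle_ineq4 by metis
      also have "norm (complex_of_real (1 - r) * w) = 1 - r"
        using elim w by (simp only: norm_mult norm_of_real) simp
      finally have "norm z \<ge> \<delta> / 2"
        using 1 True by (simp add: dist_norm norm_minus_commute)
      then show ?thesis
        using d s True
        by (auto simp: radial_majorant_def z_def[symmetric] intro!: divide_left_mono powr_mono2 mult_pos_pos)
    next
      case False
      then show ?thesis by simp
    qed
    moreover have "integrable circle_haar (\<lambda>w. indicator {w. dist w 1 \<ge> \<delta>} w * radial_majorant s r w)"
      using elim
      by (intro Bochner_Integration.integrable_bound[
            OF integrable_circle_haar_continuous[OF continuous_on_radial_majorant[of r s]]])
        (auto intro!: AE_I2 borel_measurable_times measurable_circle_haar_borel[OF borel_measurable_indicator]
          measurable_circle_haar_continuous[OF continuous_on_radial_majorant] split: split_indicator)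
    ultimately have "(LINT w|circle_haar. indicator {w. dist w 1 \<ge> \<delta>} w * radial_majorant s r w) \<le>
        (LINT w|circle_haar. (1 - r\<^sup>2) powr s / (\<delta> / 2) powr (s + 1))"
      by (intro integral_mono) auto
    then show ?case using prob_space by simp
  qed
  show "\<forall>\<^sub>F r in at 1 within {0..<1}.
      0 \<le> (LINT w|circle_haar. indicator {w. dist w 1 \<ge> \<delta>} w * radial_majorant s r w)"
    by (intro always_eventually allI Bochner_Integration.integral_nonneg) (simp add: radial_majorant_nonneg)
  have "((\<lambda>r::real. (1 - r\<^sup>2) powr s) \<longlongrightarrow> 0 powr s) (at 1 within {0..<1})"
    by (intro tendsto_powr' tendsto_const)
      (use s in \<open>auto intro!: tendsto_eq_intros eventually_mono[OF eventually_at_1_within] simp: power_le_one\<close>)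
  then show "((\<lambda>r. (1 - r\<^sup>2) powr s / (\<delta> / 2) powr (s + 1)) \<longlongrightarrow> 0) (at 1 within {0..<1})"
    using tendsto_divide[OF _ tendsto_const[of "(\<delta> / 2) powr (s + 1)"], of _ 0] d by simp
qed simp

section \<open>Integration over the torus\<close>

lemma compact_torus: "compact (torus :: (complex ^ 'n::finite) set)"
proof -
  have "closed (torus :: (complex ^ 'n) set)"
    unfolding torus_def by (intro closed_Collect_all closed_Collect_eq continuous_intros)
  moreover have "bounded (torus :: (complex ^ 'n) set)"
  proof -
    have "norm \<zeta> \<le> real CARD('n)" if "\<zeta> \<in> torus" for \<zeta> :: "complex ^ 'n"
      using that L2_set_le_sum[of UNIV "\<lambda>j. norm (\<zeta> $ j)"]
      by (simp add: norm_vec_def torus_def)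
    then show ?thesis
      unfolding bounded_iff by blast
  qed
  ultimately show ?thesis
    by (simp add: compact_eq_bounded_closed)
qed

lemma space_eq_torus: "sets N = sets torus_borel \<Longrightarrow> space N = torus"
  using sets_eq_imp_space_eq[of N torus_borel] by (simp add: space_restrict_space)

lemma continuous_on_torus_measurable:
  fixes f :: "complex ^ 'n::finite \<Rightarrow> 'b::topological_space"
  assumes f: "continuous_on torus f" and N: "sets N = sets torus_borel"
  shows "f \<in> borel_measurable N"
  unfolding measurable_cong_sets[OF N refl]
  using f by (rule borel_measurable_continuous_on_restrict)

lemma continuous_on_torus_bounded:
  fixes f :: "complex ^ 'n::finite \<Rightarrow> 'b::real_normed_vector"
  assumes f: "continuous_on torus f"
  obtains B where "B \<ge> 0" "\<And>\<zeta>. \<zeta> \<in> torus \<Longrightarrow> norm (f \<zeta>) \<le> B"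
proof -
  have "bounded (f ` torus)"
    using f compact_torus by (intro compact_imp_bounded compact_continuous_image)
  then obtain B where "\<And>\<zeta>. \<zeta> \<in> torus \<Longrightarrow> norm (f \<zeta>) \<le> B"
    unfolding bounded_iff by blast
  then show thesis
    using that[of "max B 0"] by (simp add: le_max_iff_disj)
qed

lemma continuous_on_torus_integrable:
  fixes f :: "complex ^ 'n::finite \<Rightarrow> 'b::{banach, second_countable_topology}"
  assumes f: "continuous_on torus f" and N: "sets N = sets torus_borel" and fin: "finite_measure N"
  shows "integrable N f"
proof -
  interpret finite_measure N by fact
  obtain B where "\<And>\<zeta>. \<zeta> \<in> torus \<Longrightarrow> norm (f \<zeta>) \<le> B"
    using continuous_on_torus_bounded[OF f] by blast
  then show ?thesis
    using f N by (intro integrable_const_bound[where B=B] AE_I2 continuous_on_torus_measurable)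
      (auto simp: space_eq_torus)
qed

lemma torus_component_measurable: "(\<lambda>w. w $ j) \<in> torus_borel \<rightarrow>\<^sub>M circle_haar"
proof -
  have "(\<lambda>w. w $ j) \<in> torus_borel \<rightarrow>\<^sub>M restrict_space borel (sphere 0 1)"
    by (intro measurable_restrict_space2 measurable_restrict_space1 borel_measurable_continuous_onI
        continuous_intros) (auto simp: space_restrict_space torus_def)
  then show ?thesis
    unfolding measurable_cong_sets[OF refl sets_circle_haar] .
qed

lemma
  fixes f :: "'n::finite \<Rightarrow> complex \<Rightarrow> 'b::{real_normed_field, banach, second_countable_topology}"
  assumes f: "\<And>j. integrable circle_haar (f j)"
  shows torus_haar_integrable_prod: "integrable torus_haar (\<lambda>w. \<Prod>j\<in>UNIV. f j (w $ j))"
    and torus_haar_integral_prod: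
      "(LINT w|torus_haar. (\<Prod>j\<in>UNIV. f j (w $ j))) = (\<Prod>j\<in>UNIV. LINT w|circle_haar. f j w)"
proof -
  interpret C: prob_space circle_haar by (rule prob_space_circle_haar)
  interpret product_sigma_finite "\<lambda>_::'n. circle_haar" by unfold_locales
  have meas: "(\<lambda>w. \<Prod>j\<in>UNIV. f j (w $ j)) \<in> borel_measurable torus_borel"
    by (intro borel_measurable_prod measurable_compose[OF torus_component_measurable]
        borel_measurable_integrable f)
  show "integrable torus_haar (\<lambda>w. \<Prod>j\<in>UNIV. f j (w $ j))"
    unfolding torus_haar_def
    using product_integrable_prod[of UNIV f] f
    by (subst integrable_distr_eq[OF vec_lambda_measurable_torus meas]) simp
  show "(LINT w|torus_haar. (\<Prod>j\<in>UNIV. f j (w $ j))) = (\<Prod>j\<in>UNIV. LINT w|circle_haar. f j w)"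
    unfolding torus_haar_def
    using product_integral_prod[of UNIV f] f
    by (subst integral_distr[OF vec_lambda_measurable_torus meas]) simp
qed

section \<open>The kernel on the torus as an approximate identity\<close>

text \<open>
  The Poisson kernel at \<open>(r \<zeta>, \<eta>)\<close>, as a function of the quotient \<open>w = \<zeta> / \<eta>\<close> in the group \<^const>\<open>torus\<close>.
\<close>
definition torus_kernel :: "complex ^ 'n::finite \<Rightarrow> complex ^ 'n \<Rightarrow> real ^ 'n \<Rightarrow> complex ^ 'n \<Rightarrow> complex" where
  "torus_kernel \<alpha> \<beta> r w =
     (\<Prod>j\<in>UNIV. poisson_const (\<alpha> $ j) (\<beta> $ j) * poisson_factor (\<alpha> $ j) (\<beta> $ j) (r $ j) (w $ j))"

definition torus_quotient :: "complex ^ 'n \<Rightarrow> complex ^ 'n \<Rightarrow> complex ^ 'n" where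
  "torus_quotient \<zeta> \<eta> = (\<chi> j. \<zeta> $ j * cnj (\<eta> $ j))"

definition unit_cube :: "(real ^ 'n) set" where
  "unit_cube = {r. \<forall>j. 0 \<le> r $ j \<and> r $ j < 1}"

text \<open>
  On dilates of the torus the Poisson integral is a convolution on the group \<^const>\<open>torus\<close>.
\<close>
lemma poisson_kernel_dilation:
  assumes "\<zeta> \<in> torus"
  shows "poisson_kernel \<alpha> \<beta> (\<chi> j. complex_of_real (r $ j) * \<zeta> $ j) \<eta> =
    torus_kernel \<alpha> \<beta> r (torus_quotient \<zeta> \<eta>)"
  using assms
  by (simp add: poisson_kernel_def torus_kernel_def torus_quotient_def poisson_factor_def torus_def
      norm_mult mult.assoc)

lemma torus_quotient_in_torus: "\<zeta> \<in> torus \<Longrightarrow> \<eta> \<in> torus \<Longrightarrow> torus_quotient \<zeta> \<eta> \<in> torus"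
  by (simp add: torus_quotient_def torus_def norm_mult)

lemma torus_quotient_mult:
  assumes "\<eta> \<in> torus"
  shows "torus_quotient (\<chi> j. \<eta> $ j * w $ j) \<eta> = w"
proof -
  have "\<eta> $ j * cnj (\<eta> $ j) = 1" for j
    using assms by (simp add: torus_def complex_norm_square[symmetric])
  then have "\<eta> $ j * w $ j * cnj (\<eta> $ j) = w $ j" for j
    by (metis mult.assoc mult.commute mult.right_neutral)
  then show ?thesis
    by (simp add: torus_quotient_def vec_eq_iff)
qed

lemma continuous_on_torus_kernel:
  fixes \<alpha> \<beta> :: "complex ^ 'n::finite"
  assumes r: "r \<in> unit_cube"
  shows "continuous_on torus (torus_kernel \<alpha> \<beta> r)"
proof -
  have "continuous_on torus (\<lambda>w::complex ^ 'n. poisson_factor (\<alpha> $ j) (\<beta> $ j) (r $ j) (w $ j))" for j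
    using r by (intro continuous_on_compose2[OF continuous_on_poisson_factor] continuous_intros)
      (auto simp: unit_cube_def torus_def)
  then show ?thesis
    unfolding torus_kernel_def by (intro continuous_intros)
qed

lemma torus_haar_integral_rotate:
  fixes G :: "complex ^ 'n::finite \<Rightarrow> complex"
  assumes "\<eta> \<in> torus" "continuous_on torus G"
  shows "(LINT \<zeta>|torus_haar. G \<zeta>) = (LINT w|torus_haar. G (\<chi> j. \<eta> $ j * w $ j))"
proof -
  have "(\<lambda>\<zeta>. \<chi> j. \<eta> $ j * \<zeta> $ j) \<in> torus_borel \<rightarrow>\<^sub>M torus_borel"
    using assms(1) by (intro measurable_restrict_space2 measurable_restrict_space1
        borel_measurable_continuous_onI continuous_intros)
      (auto simp: space_restrict_space norm_mult torus_def)
  then have "(\<lambda>\<zeta>. \<chi> j. \<eta> $ j * \<zeta> $ j) \<in> torus_haar \<rightarrow>\<^sub>M torus_borel"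
    unfolding measurable_cong_sets[OF sets_torus_haar refl] .
  then have "(LINT \<zeta>|distr torus_haar torus_borel (\<lambda>\<zeta>. \<chi> j. \<eta> $ j * \<zeta> $ j). G \<zeta>) =
      (LINT w|torus_haar. G (\<chi> j. \<eta> $ j * w $ j))"
    using assms(2) by (intro integral_distr continuous_on_torus_measurable) auto
  then show ?thesis
    by (simp add: torus_haar_rotate[OF assms(1)])
qed

lemma eventually_unit_cube:
  "\<forall>\<^sub>F r in at (\<chi> j. 1) within (unit_cube :: (real ^ 'n::finite) set). r \<in> unit_cube"
  by (simp add: eventually_at_filter)

lemma filterlim_component_unit_cube:
  "filterlim (\<lambda>r. r $ j) (at 1 within {0..<1}) (at (\<chi> j. 1) within (unit_cube :: (real ^ 'n::finite) set))"
  unfolding filterlim_at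
proof
  show "\<forall>\<^sub>F r in at (\<chi> j. 1) within (unit_cube :: (real ^ 'n) set). r $ j \<in> {0..<1} \<and> r $ j \<noteq> 1"
    using eventually_unit_cube by eventually_elim (auto simp: unit_cube_def less_imp_neq)
  show "((\<lambda>r. r $ j) \<longlongrightarrow> 1) (at (\<chi> j. 1) within (unit_cube :: (real ^ 'n) set))"
    by (rule tendsto_eq_intros) (auto intro: tendsto_eq_intros)
qed

lemma integrable_poisson_factor:
  "r \<in> unit_cube \<Longrightarrow> integrable circle_haar (poisson_factor a b (r $ j))"
  by (auto simp: unit_cube_def intro!: integrable_circle_haar_continuous continuous_on_poisson_factor)

lemma integrable_radial_majorant:
  "r \<in> unit_cube \<Longrightarrow> integrable circle_haar (radial_majorant s (r $ j))"
  by (auto simp: unit_cube_def intro!: integrable_circle_haar_continuous continuous_on_radial_majorant)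

lemma not_nonpos_Int_plus_1:
  fixes a :: complex
  assumes "a \<notin> {- of_nat k | k. k \<ge> 1}"
  shows "a + 1 \<notin> \<int>\<^sub>\<le>\<^sub>0"
proof
  assume "a + 1 \<in> \<int>\<^sub>\<le>\<^sub>0"
  then obtain n where "a + 1 = - of_nat n" by (auto elim!: nonpos_Ints_cases')
  then have "a = - of_nat n - 1" by (metis add_diff_cancel_right')
  then have "a = - of_nat (Suc n)" by simp
  then show False using assms by (auto dest!: spec[of _ "Suc n"])
qed

text \<open>
  The constant \<^const>\<open>poisson_const\<close> is the reciprocal of the limit of the integral of each factor.
\<close>
lemma tendsto_torus_kernel_integral:
  fixes \<alpha> \<beta> :: "complex ^ 'n::finite"
  assumes pos: "\<And>j. Re (\<alpha> $ j) + Re (\<beta> $ j) > -1"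
    and \<alpha>: "\<And>j. \<alpha> $ j + 1 \<notin> \<int>\<^sub>\<le>\<^sub>0" and \<beta>: "\<And>j. \<beta> $ j + 1 \<notin> \<int>\<^sub>\<le>\<^sub>0"
  shows "((\<lambda>r. LINT w|torus_haar. torus_kernel \<alpha> \<beta> r w) \<longlongrightarrow> 1) (at (\<chi> j. 1) within unit_cube)"
proof -
  let ?c = "\<lambda>j. poisson_const (\<alpha> $ j) (\<beta> $ j)"
  let ?L = "\<lambda>j. Gamma (\<alpha> $ j + \<beta> $ j + 1) / (Gamma (\<alpha> $ j + 1) * Gamma (\<beta> $ j + 1))"
  have "?c j * ?L j = 1" for j
  proof -
    have "\<alpha> $ j + \<beta> $ j + 1 \<notin> \<int>\<^sub>\<le>\<^sub>0"
    proof
      assume "\<alpha> $ j + \<beta> $ j + 1 \<in> \<int>\<^sub>\<le>\<^sub>0"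
      then obtain n where "\<alpha> $ j + \<beta> $ j + 1 = of_int n" "n \<le> 0" by (rule nonpos_Ints_cases)
      then have "Re (\<alpha> $ j + \<beta> $ j + 1) \<le> 0" by (simp only: complex_Re_of_int of_int_le_0_iff)
      then show False using pos[of j] by simp
    qed
    then show ?thesis
      using \<alpha>[of j] \<beta>[of j] by (simp add: poisson_const_def Gamma_eq_zero_iff)
  qed
  moreover have "((\<lambda>r. \<Prod>j\<in>UNIV. ?c j * (LINT w|circle_haar. poisson_factor (\<alpha> $ j) (\<beta> $ j) (r $ j) w)) \<longlongrightarrow>
      (\<Prod>j\<in>UNIV. ?c j * ?L j)) (at (\<chi> j. 1) within unit_cube)"
    by (intro tendsto_prod tendsto_mult tendsto_const
        filterlim_compose[OF tendsto_poisson_factor_integral filterlim_component_unit_cube] \<alpha> \<beta> pos)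
  ultimately have lim: "((\<lambda>r. \<Prod>j\<in>UNIV. ?c j * (LINT w|circle_haar. poisson_factor (\<alpha> $ j) (\<beta> $ j) (r $ j) w)) \<longlongrightarrow> 1)
      (at (\<chi> j. 1) within unit_cube)"
    by simp
  have "\<forall>\<^sub>F r in at (\<chi> j. 1) within unit_cube.
     (\<Prod>j\<in>UNIV. ?c j * (LINT w|circle_haar. poisson_factor (\<alpha> $ j) (\<beta> $ j) (r $ j) w)) =
     (LINT w|torus_haar. torus_kernel \<alpha> \<beta> r w)"
    using eventually_unit_cube
  proof eventually_elim
    case (elim r)
    then show ?case
      unfolding torus_kernel_def
      by (subst torus_haar_integral_prod) (auto intro!: integrable_mult_right integrable_poisson_factor)
  qed
  then show ?thesis
    by (rule Lim_transform_eventually[OF lim])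
qed

text \<open>
  The usual three properties of an approximate identity: the integral of the kernel tends to 1, its
  modulus has a majorant \<open>H\<close> of bounded mass, and the mass of \<open>H\<close> away from the unit of the group
  tends to 0. Close to the unit, uniform continuity of \<open>\<phi>\<close> makes the oscillation small; away from it,
  some coordinate \<open>i\<close> is at distance \<open>\<delta>\<close> from 1, and the corresponding part \<open>T r i\<close> of \<open>H\<close> is a product
  one of whose factors has an integral tending to 0. The bound \<open>b r\<close> does not depend on \<open>\<eta>\<close>, which
  gives the uniformity.
\<close>
lemma torus_kernel_approximate_identity:
  fixes \<alpha> \<beta> :: "complex ^ 'n::finite" and \<phi> :: "complex ^ 'n \<Rightarrow> complex"
  assumes pos: "\<And>j. Re (\<alpha> $ j) + Re (\<beta> $ j) > -1"
    and \<alpha>: "\<And>j. \<alpha> $ j + 1 \<notin> \<int>\<^sub>\<le>\<^sub>0" and \<beta>: "\<And>j. \<beta> $ j + 1 \<notin> \<int>\<^sub>\<le>\<^sub>0"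
    and \<phi>: "continuous_on torus \<phi>" and \<epsilon>: "\<epsilon> > 0"
  shows "\<forall>\<^sub>F r in at (\<chi> j. 1) within unit_cube. \<forall>\<eta>\<in>torus.
    norm ((LINT w|torus_haar. \<phi> (\<chi> j. \<eta> $ j * w $ j) * torus_kernel \<alpha> \<beta> r w) - \<phi> \<eta>) < \<epsilon>"
proof -
  interpret T: prob_space "torus_haar :: (complex ^ 'n) measure" by (rule prob_space_torus_haar)
  define F where "F = at (\<chi> j. 1) within (unit_cube :: (real ^ 'n) set)"
  define C where "C j = norm (poisson_const (\<alpha> $ j) (\<beta> $ j)) * exp (pi * (\<bar>Im (\<alpha> $ j)\<bar> + \<bar>Im (\<beta> $ j)\<bar>))" for j
  define s where "s j = Re (\<alpha> $ j) + Re (\<beta> $ j) + 1" for j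
  have s: "s j > 0" for j using pos[of j] by (simp add: s_def)
  define h where "h r j z = C j * radial_majorant (s j) (r $ j) z" for r :: "real ^ 'n" and j z
  define H where "H r w = (\<Prod>j\<in>UNIV. h r j (w $ j))" for r and w :: "complex ^ 'n"
  have C0: "C j \<ge> 0" for j by (simp add: C_def)
  have h0: "h r j z \<ge> 0" for r j z using C0[of j] radial_majorant_nonneg by (simp add: h_def)
  have H0: "H r w \<ge> 0" for r w using h0 by (simp add: H_def prod_nonneg)
  have inth: "integrable circle_haar (h r j)" if "r \<in> unit_cube" for r j
    unfolding h_def[abs_def] by (intro integrable_mult_right integrable_radial_majorant that)
  have intH: "integrable torus_haar (H r)" if "r \<in> unit_cube" for r
    unfolding H_def[abs_def] by (intro torus_haar_integrable_prod inth that)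
  have KH: "norm (torus_kernel \<alpha> \<beta> r w) \<le> H r w" if r: "r \<in> unit_cube" and w: "w \<in> torus" for r w
    unfolding torus_kernel_def H_def prod_norm[symmetric]
  proof (intro prod_mono conjI norm_ge_zero)
    fix j
    have "norm (poisson_factor (\<alpha> $ j) (\<beta> $ j) (r $ j) (w $ j)) \<le>
        exp (pi * (\<bar>Im (\<alpha> $ j)\<bar> + \<bar>Im (\<beta> $ j)\<bar>)) * radial_majorant (s j) (r $ j) (w $ j)"
      unfolding s_def using r w by (intro norm_poisson_factor_le) (auto simp: unit_cube_def torus_def)
    from mult_left_mono[OF this norm_ge_zero[of "poisson_const (\<alpha> $ j) (\<beta> $ j)"]]
    show "norm (poisson_const (\<alpha> $ j) (\<beta> $ j) * poisson_factor (\<alpha> $ j) (\<beta> $ j) (r $ j) (w $ j)) \<le> h r j (w $ j)"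
      by (simp add: h_def C_def norm_mult mult.assoc)
  qed
  have "\<exists>l. \<forall>j. ((\<lambda>r. LINT w|circle_haar. radial_majorant (s j) r w) \<longlongrightarrow> l j) (at 1 within {0..<1})"
    using convergent_radial_majorant_integral[OF s] by (intro choice) blast
  then obtain l where l: "\<And>j. ((\<lambda>r. LINT w|circle_haar. radial_majorant (s j) r w) \<longlongrightarrow> l j) (at 1 within {0..<1})"
    by blast
  have limh: "((\<lambda>r. LINT w|circle_haar. h r j w) \<longlongrightarrow> C j * l j) F" for j
    unfolding h_def F_def integral_mult_right_zero
    by (intro tendsto_mult tendsto_const filterlim_compose[OF l filterlim_component_unit_cube])
  define \<Lambda> where "\<Lambda> = (\<Prod>j\<in>UNIV. C j * l j)"
  have limH: "((\<lambda>r. LINT w|torus_haar. H r w) \<longlongrightarrow> \<Lambda>) F"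
  proof (rule Lim_transform_eventually)
    show "((\<lambda>r. \<Prod>j\<in>UNIV. LINT w|circle_haar. h r j w) \<longlongrightarrow> \<Lambda>) F"
      unfolding \<Lambda>_def by (intro tendsto_prod limh)
    show "\<forall>\<^sub>F r in F. (\<Prod>j\<in>UNIV. LINT w|circle_haar. h r j w) = (LINT w|torus_haar. H r w)"
      using eventually_unit_cube unfolding F_def
      by eventually_elim (simp add: H_def torus_haar_integral_prod inth)
  qed
  \<comment> \<open>The limit \<open>\<Lambda>\<close> of the masses of \<open>H\<close> multiplies the oscillation \<open>\<epsilon>'\<close> in the final bound.\<close>
  define \<epsilon>' where "\<epsilon>' = \<epsilon> / (\<bar>\<Lambda>\<bar> + 1)"
  have \<epsilon>': "\<epsilon>' > 0" "\<epsilon>' * \<Lambda> < \<epsilon>"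
  proof -
    show "\<epsilon>' > 0" using \<epsilon> by (simp add: \<epsilon>'_def add_nonneg_pos)
    then have "\<epsilon>' * \<Lambda> < \<epsilon>' * (\<bar>\<Lambda>\<bar> + 1)" by (intro mult_strict_left_mono) auto
    also have "\<dots> = \<epsilon>" by (simp add: \<epsilon>'_def add_nonneg_eq_0_iff)
    finally show "\<epsilon>' * \<Lambda> < \<epsilon>" .
  qed
  obtain M where M: "M \<ge> 0" "\<And>\<zeta>. \<zeta> \<in> torus \<Longrightarrow> norm (\<phi> \<zeta>) \<le> M"
    using continuous_on_torus_bounded[OF \<phi>] by blast
  have "uniformly_continuous_on torus \<phi>"
    using \<phi> compact_torus by (rule compact_uniformly_continuous)
  then obtain \<delta>0 where \<delta>0: "\<delta>0 > 0"
    "\<And>x y. x \<in> torus \<Longrightarrow> y \<in> torus \<Longrightarrow> dist y x < \<delta>0 \<Longrightarrow> dist (\<phi> y) (\<phi> x) < \<epsilon>'"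
    unfolding uniformly_continuous_on_def using \<epsilon>'(1) by metis
  \<comment> \<open>A displacement is at most the sum of the displacements of the coordinates.\<close>
  define \<delta> where "\<delta> = \<delta>0 / real CARD('n)"
  have \<delta>: "\<delta> > 0" using \<delta>0(1) by (simp add: \<delta>_def)
  have mult_torus: "(\<chi> j. \<eta> $ j * w $ j) \<in> torus" if "\<eta> \<in> torus" "w \<in> torus" for \<eta> w :: "complex ^ 'n"
    using that by (simp add: torus_def norm_mult)
  have close: "norm (\<phi> (\<chi> j. \<eta> $ j * w $ j) - \<phi> \<eta>) \<le> \<epsilon>'"
    if \<eta>: "\<eta> \<in> torus" and w: "w \<in> torus" and near: "\<And>j. dist (w $ j) 1 < \<delta>" for \<eta> w
  proof -
    have "dist (\<chi> j. \<eta> $ j * w $ j) \<eta> \<le> (\<Sum>j\<in>UNIV. norm (\<eta> $ j * w $ j - \<eta> $ j))"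
      unfolding dist_norm norm_vec_def using L2_set_le_sum[of UNIV "\<lambda>j. norm (\<eta> $ j * w $ j - \<eta> $ j)"]
      by simp
    also have "\<dots> < real CARD('n) * \<delta>"
    proof (rule sum_bounded_above_strict)
      fix j
      have "\<eta> $ j * w $ j - \<eta> $ j = \<eta> $ j * (w $ j - 1)" by (simp add: algebra_simps)
      then show "norm (\<eta> $ j * w $ j - \<eta> $ j) < \<delta>"
        using near[of j] \<eta> by (simp add: norm_mult torus_def dist_norm)
    qed simp
    also have "\<dots> = \<delta>0" by (simp add: \<delta>_def)
    finally show ?thesis
      using \<delta>0(2)[OF \<eta> mult_torus[OF \<eta> w]] by (simp add: dist_norm)
  qed
  define far where "far i z = (indicator {z. dist z 1 \<ge> \<delta>} z :: real)" for i :: 'n and z :: complex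
  define g where "g r i j z = (if j = i then far i z * h r j z else h r j z)" for r i j z
  define T where "T r i w = (\<Prod>j\<in>UNIV. g r i j (w $ j))" for r i and w :: "complex ^ 'n"
  have T_eq: "T r i w = far i (w $ i) * H r w" for r i w
  proof -
    have "T r i w = (\<Prod>j\<in>UNIV. (if j = i then far i (w $ i) else 1) * h r j (w $ j))"
      unfolding T_def g_def by (intro prod.cong) auto
    then show ?thesis by (simp add: prod.distrib H_def)
  qed
  have intg: "integrable circle_haar (g r i j)" if r: "r \<in> unit_cube" for r i j
  proof (cases "j = i")
    case True
    have "integrable circle_haar (\<lambda>z. far i z * h r j z)"
      by (rule Bochner_Integration.integrable_bound[OF inth[OF r, of j]])
        (auto simp: far_def[abs_def] intro!: AE_I2 borel_measurable_times
          measurable_circle_haar_borel[OF borel_measurable_indicator]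
          borel_measurable_integrable[OF inth[OF r]] split: split_indicator)
    then show ?thesis using True by (simp add: g_def[abs_def])
  next
    case False
    then show ?thesis using inth[OF r, of j] by (simp add: g_def[abs_def])
  qed
  have intT: "integrable torus_haar (T r i)" if r: "r \<in> unit_cube" for r i
    unfolding T_def[abs_def] by (intro torus_haar_integrable_prod intg r)
  have limT: "((\<lambda>r. LINT w|torus_haar. T r i w) \<longlongrightarrow> 0) F" for i
  proof (rule Lim_transform_eventually)
    have "((\<lambda>r. LINT z|circle_haar. g r i j z) \<longlongrightarrow> (if j = i then 0 else C j * l j)) F" for j
    proof (cases "j = i")
      case True
      have "((\<lambda>r. C i * (LINT z|circle_haar. far i z * radial_majorant (s i) (r $ i) z)) \<longlongrightarrow> C i * 0) F"
        unfolding F_def far_def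
        by (intro tendsto_mult tendsto_const
            filterlim_compose[OF tendsto_radial_majorant_tail filterlim_component_unit_cube] s \<delta>)
      also have "(\<lambda>r. C i * (LINT z|circle_haar. far i z * radial_majorant (s i) (r $ i) z)) =
          (\<lambda>r. LINT z|circle_haar. g r i j z)"
        unfolding integral_mult_right_zero[symmetric] using True
        by (intro ext Bochner_Integration.integral_cong refl) (simp add: g_def h_def)
      finally show ?thesis using True by simp
    next
      case False
      then show ?thesis using limh[of j] by (simp add: g_def)
    qed
    then have "((\<lambda>r. \<Prod>j\<in>UNIV. LINT z|circle_haar. g r i j z) \<longlongrightarrow> (\<Prod>j\<in>UNIV. if j = i then 0 else C j * l j)) F"
      by (intro tendsto_prod)
    moreover have "(\<Prod>j\<in>UNIV. if j = i then 0 else C j * l j) = 0"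
      by (intro prod_zero) auto
    ultimately show "((\<lambda>r. \<Prod>j\<in>UNIV. LINT z|circle_haar. g r i j z) \<longlongrightarrow> 0) F"
      by simp
    show "\<forall>\<^sub>F r in F. (\<Prod>j\<in>UNIV. LINT z|circle_haar. g r i j z) = (LINT w|torus_haar. T r i w)"
      using eventually_unit_cube unfolding F_def
      by eventually_elim (simp add: T_def torus_haar_integral_prod intg)
  qed
  define b where "b r = M * norm ((LINT w|torus_haar. torus_kernel \<alpha> \<beta> r w) - 1) +
    (\<epsilon>' * (LINT w|torus_haar. H r w) + 2 * M * (\<Sum>i\<in>UNIV. LINT w|torus_haar. T r i w))" for r
  have "((\<lambda>r. LINT w|torus_haar. torus_kernel \<alpha> \<beta> r w) \<longlongrightarrow> 1) F"
    unfolding F_def by (intro tendsto_torus_kernel_integral pos \<alpha> \<beta>)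
  then have "(b \<longlongrightarrow> M * norm (1 - 1 :: complex) + (\<epsilon>' * \<Lambda> + 2 * M * (\<Sum>i\<in>(UNIV :: 'n set). 0))) F"
    unfolding b_def[abs_def] by (intro tendsto_intros limH limT)
  then have "(b \<longlongrightarrow> \<epsilon>' * \<Lambda>) F" by simp
  then have ev_b: "\<forall>\<^sub>F r in F. b r < \<epsilon>"
    using \<epsilon>'(2) by (rule order_tendstoD(2))
  have bound: "norm ((LINT w|torus_haar. \<phi> (\<chi> j. \<eta> $ j * w $ j) * torus_kernel \<alpha> \<beta> r w) - \<phi> \<eta>) \<le> b r"
    if r: "r \<in> unit_cube" and \<eta>: "\<eta> \<in> torus" for r \<eta>
  proof -
    let ?K = "torus_kernel \<alpha> \<beta> r" and ?\<phi> = "\<lambda>w. \<phi> (\<chi> j. \<eta> $ j * w $ j)"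
    have cont: "continuous_on torus ?\<phi>" "continuous_on torus ?K"
      using \<phi> continuous_on_torus_kernel[OF r] mult_torus[OF \<eta>]
      by (auto intro!: continuous_on_compose2[OF \<phi>] continuous_intros)
    have int: "integrable torus_haar f" if "continuous_on torus f" for f :: "complex ^ 'n \<Rightarrow> complex"
      using that by (intro continuous_on_torus_integrable) (auto intro: T.finite_measure_axioms)
    have int1: "integrable torus_haar (\<lambda>w. (?\<phi> w - \<phi> \<eta>) * ?K w)"
      by (intro int continuous_intros cont)
    have int2: "integrable torus_haar (\<lambda>w. ?\<phi> w * ?K w)"
      by (intro int continuous_intros cont)
    have int3: "integrable torus_haar (\<lambda>w. \<phi> \<eta> * ?K w)"
      by (intro int continuous_intros cont)
    have intR: "integrable torus_haar (\<lambda>w. \<epsilon>' * H r w + 2 * M * (\<Sum>i\<in>UNIV. T r i w))"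
      by (intro Bochner_Integration.integrable_add integrable_mult_right Bochner_Integration.integrable_sum
          intH intT r)
    have "(LINT w|torus_haar. (?\<phi> w - \<phi> \<eta>) * ?K w) =
        (LINT w|torus_haar. ?\<phi> w * ?K w) - \<phi> \<eta> * (LINT w|torus_haar. ?K w)"
      using Bochner_Integration.integral_diff[OF int2 int3] by (simp add: left_diff_distrib)
    then have split: "(LINT w|torus_haar. ?\<phi> w * ?K w) - \<phi> \<eta> =
        \<phi> \<eta> * ((LINT w|torus_haar. ?K w) - 1) + (LINT w|torus_haar. (?\<phi> w - \<phi> \<eta>) * ?K w)"
      by (simp add: algebra_simps)
    have "norm ((LINT w|torus_haar. ?\<phi> w * ?K w) - \<phi> \<eta>) \<le>
        norm (\<phi> \<eta>) * norm ((LINT w|torus_haar. ?K w) - 1) + norm (LINT w|torus_haar. (?\<phi> w - \<phi> \<eta>) * ?K w)"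
      unfolding split norm_mult[symmetric] by (rule norm_triangle_ineq)
    also have "\<dots> \<le> M * norm ((LINT w|torus_haar. ?K w) - 1) +
        (LINT w|torus_haar. \<epsilon>' * H r w + 2 * M * (\<Sum>i\<in>UNIV. T r i w))"
    proof (intro add_mono mult_right_mono norm_ge_zero M(2) \<eta>)
      have pt: "norm ((?\<phi> w - \<phi> \<eta>) * ?K w) \<le> \<epsilon>' * H r w + 2 * M * (\<Sum>i\<in>UNIV. T r i w)"
        if w: "w \<in> torus" for w
      proof -
        have T0: "T r i w \<ge> 0" for i using H0[of r w] by (simp add: T_eq far_def)
        have le: "norm ((?\<phi> w - \<phi> \<eta>) * ?K w) \<le> norm (?\<phi> w - \<phi> \<eta>) * H r w"
          unfolding norm_mult by (intro mult_left_mono KH r w) auto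
        show ?thesis
        proof (cases "\<forall>j. dist (w $ j) 1 < \<delta>")
          case True
          then have "norm (?\<phi> w - \<phi> \<eta>) * H r w \<le> \<epsilon>' * H r w"
            by (intro mult_right_mono close \<eta> w H0) auto
          moreover have "0 \<le> 2 * M * (\<Sum>i\<in>UNIV. T r i w)"
            using M(1) T0 by (simp add: sum_nonneg)
          ultimately show ?thesis using le by linarith
        next
          case False
          then obtain i where "dist (w $ i) 1 \<ge> \<delta>" by (auto simp: not_less)
          then have "H r w = T r i w" by (simp add: T_eq far_def)
          also have "\<dots> \<le> (\<Sum>i\<in>UNIV. T r i w)" using T0 by (intro member_le_sum) auto
          finally have HT: "H r w \<le> (\<Sum>i\<in>UNIV. T r i w)" .
          have "norm (?\<phi> w - \<phi> \<eta>) \<le> 2 * M"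
            using norm_triangle_ineq4[of "?\<phi> w" "\<phi> \<eta>"] M(2)[OF mult_torus[OF \<eta> w]] M(2)[OF \<eta>] by linarith
          then have "norm (?\<phi> w - \<phi> \<eta>) * H r w \<le> 2 * M * (\<Sum>i\<in>UNIV. T r i w)"
            using HT H0 M(1) by (intro mult_mono) auto
          moreover have "0 \<le> \<epsilon>' * H r w" using \<epsilon>'(1) H0[of r w] by simp
          ultimately show ?thesis using le by linarith
        qed
      qed
      have "norm (LINT w|torus_haar. (?\<phi> w - \<phi> \<eta>) * ?K w) \<le>
          (LINT w|torus_haar. norm ((?\<phi> w - \<phi> \<eta>) * ?K w))"
        by (rule integral_norm_bound)
      also have "\<dots> \<le> (LINT w|torus_haar. \<epsilon>' * H r w + 2 * M * (\<Sum>i\<in>UNIV. T r i w))"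
        using pt by (intro integral_mono integrable_norm int1 intR) (simp add: space_eq_torus)
      finally show "norm (LINT w|torus_haar. (?\<phi> w - \<phi> \<eta>) * ?K w) \<le>
          (LINT w|torus_haar. \<epsilon>' * H r w + 2 * M * (\<Sum>i\<in>UNIV. T r i w))" .
    qed
    also have "\<dots> = b r"
      using intH[OF r] intT[OF r]
      by (simp add: b_def Bochner_Integration.integral_add Bochner_Integration.integral_sum
          Bochner_Integration.integrable_sum)
    finally show ?thesis .
  qed
  show ?thesis
    using ev_b eventually_unit_cube unfolding F_def
    by eventually_elim (use bound le_less_trans in blast)
qed

section \<open>Weak* convergence\<close>

lemma torus_quotient_measurable:
  "(\<lambda>(\<zeta>, \<eta>). torus_quotient \<zeta> \<eta>) \<in>
     (torus_borel :: (complex ^ 'n::finite) measure) \<Otimes>\<^sub>M torus_borel \<rightarrow>\<^sub>M torus_borel"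
proof (rule measurable_restrict_space2)
  let ?T = "torus_borel :: (complex ^ 'n) measure"
  show "(\<lambda>(\<zeta>, \<eta>). torus_quotient \<zeta> \<eta>) \<in> space (?T \<Otimes>\<^sub>M ?T) \<rightarrow> torus"
    by (auto simp: space_pair_measure space_restrict_space torus_quotient_in_torus)
  have id: "(\<lambda>x. x) \<in> ?T \<rightarrow>\<^sub>M borel" by (intro measurable_restrict_space1) auto
  have "(\<lambda>p. (fst p, snd p)) \<in> ?T \<Otimes>\<^sub>M ?T \<rightarrow>\<^sub>M borel"
    by (intro borel_measurable_Pair measurable_compose[OF measurable_fst id]
        measurable_compose[OF measurable_snd id])
  moreover have "(\<lambda>p::(complex ^ 'n) \<times> (complex ^ 'n). torus_quotient (fst p) (snd p)) \<in> borel \<rightarrow>\<^sub>M borel"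
    unfolding torus_quotient_def by (intro borel_measurable_continuous_onI continuous_intros)
  ultimately have "(\<lambda>p. torus_quotient (fst p) (snd p)) \<in> ?T \<Otimes>\<^sub>M ?T \<rightarrow>\<^sub>M borel"
    by (auto dest: measurable_compose)
  then show "(\<lambda>(\<zeta>, \<eta>). torus_quotient \<zeta> \<eta>) \<in> ?T \<Otimes>\<^sub>M ?T \<rightarrow>\<^sub>M borel"
    by (simp add: case_prod_unfold)
qed

text \<open>
  Testing the convolution of the kernel with \<open>N\<close> against \<open>\<phi>\<close> amounts to integrating a smoothed version of
  \<open>\<phi>\<close> against \<open>N\<close>: exchange the integrals, then substitute \<open>\<zeta> = \<eta> w\<close> by invariance of Haar measure.
\<close>
lemma torus_kernel_Fubini:
  fixes \<alpha> \<beta> :: "complex ^ 'n::finite" and \<phi> :: "complex ^ 'n \<Rightarrow> complex"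
  assumes r: "r \<in> unit_cube" and \<phi>: "continuous_on torus \<phi>"
    and fin: "finite_measure N" and N: "sets N = sets torus_borel"
  shows "integrable torus_haar (\<lambda>\<zeta>. \<phi> \<zeta> * (LINT \<eta>|N. torus_kernel \<alpha> \<beta> r (torus_quotient \<zeta> \<eta>)))"
    and "integrable N (\<lambda>\<eta>. LINT w|torus_haar. \<phi> (\<chi> j. \<eta> $ j * w $ j) * torus_kernel \<alpha> \<beta> r w)"
    and "(LINT \<zeta>|torus_haar. \<phi> \<zeta> * (LINT \<eta>|N. torus_kernel \<alpha> \<beta> r (torus_quotient \<zeta> \<eta>))) =
      (LINT \<eta>|N. LINT w|torus_haar. \<phi> (\<chi> j. \<eta> $ j * w $ j) * torus_kernel \<alpha> \<beta> r w)"
proof -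
  let ?m = "torus_haar :: (complex ^ 'n) measure"
  let ?K = "torus_kernel \<alpha> \<beta> r"
  interpret m: prob_space ?m by (rule prob_space_torus_haar)
  interpret N: finite_measure N by fact
  interpret pair_sigma_finite ?m N by unfold_locales
  interpret P: finite_measure "?m \<Otimes>\<^sub>M N"
    by (intro finite_measure_pair_measure m.finite_measure_axioms fin)
  have sets_eq: "sets (?m \<Otimes>\<^sub>M N) = sets (torus_borel \<Otimes>\<^sub>M torus_borel)"
    by (intro sets_pair_measure_cong sets_torus_haar N)
  have K: "continuous_on torus ?K" by (rule continuous_on_torus_kernel[OF r])
  obtain B where B: "B \<ge> 0" "\<And>w. w \<in> torus \<Longrightarrow> norm (?K w) \<le> B"
    using continuous_on_torus_bounded[OF K] by blast
  obtain M where M: "M \<ge> 0" "\<And>\<zeta>. \<zeta> \<in> torus \<Longrightarrow> norm (\<phi> \<zeta>) \<le> M"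
    using continuous_on_torus_bounded[OF \<phi>] by blast
  have int: "integrable (?m \<Otimes>\<^sub>M N) (\<lambda>(\<zeta>, \<eta>). \<phi> \<zeta> * ?K (torus_quotient \<zeta> \<eta>))"
  proof (rule P.integrable_const_bound)
    show "AE p in ?m \<Otimes>\<^sub>M N. norm (case p of (\<zeta>, \<eta>) \<Rightarrow> \<phi> \<zeta> * ?K (torus_quotient \<zeta> \<eta>)) \<le> M * B"
      using N by (intro AE_I2)
        (auto simp: space_pair_measure space_eq_torus norm_mult intro!: mult_mono M B torus_quotient_in_torus)
    have "(\<lambda>p. ?K (case p of (\<zeta>, \<eta>) \<Rightarrow> torus_quotient \<zeta> \<eta>)) \<in> borel_measurable (torus_borel \<Otimes>\<^sub>M torus_borel)"
      by (rule measurable_compose[OF torus_quotient_measurable]) (rule continuous_on_torus_measurable[OF K refl])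
    moreover have "(\<lambda>p. \<phi> (fst p)) \<in> borel_measurable (torus_borel \<Otimes>\<^sub>M torus_borel)"
      by (rule measurable_compose[OF measurable_fst]) (rule continuous_on_torus_measurable[OF \<phi> refl])
    ultimately have "(\<lambda>p. \<phi> (fst p) * ?K (case p of (\<zeta>, \<eta>) \<Rightarrow> torus_quotient \<zeta> \<eta>)) \<in>
        borel_measurable (torus_borel \<Otimes>\<^sub>M torus_borel)"
      by (intro borel_measurable_times)
    then show "(\<lambda>(\<zeta>, \<eta>). \<phi> \<zeta> * ?K (torus_quotient \<zeta> \<eta>)) \<in> borel_measurable (?m \<Otimes>\<^sub>M N)"
      unfolding measurable_cong_sets[OF sets_eq refl] by (simp add: case_prod_unfold)
  qed
  have rot: "(LINT \<zeta>|?m. \<phi> \<zeta> * ?K (torus_quotient \<zeta> \<eta>)) =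
      (LINT w|?m. \<phi> (\<chi> j. \<eta> $ j * w $ j) * ?K w)" if \<eta>: "\<eta> \<in> space N" for \<eta>
  proof -
    have \<eta>: "\<eta> \<in> torus" using \<eta> N by (simp add: space_eq_torus)
    have "continuous_on torus (\<lambda>\<zeta>. \<phi> \<zeta> * ?K (torus_quotient \<zeta> \<eta>))"
      using \<eta> by (intro continuous_on_mult \<phi> continuous_on_compose2[OF K])
        (auto simp: torus_quotient_in_torus, auto simp: torus_quotient_def intro!: continuous_intros)
    from torus_haar_integral_rotate[OF \<eta> this] show ?thesis
      by (simp add: torus_quotient_mult[OF \<eta>])
  qed
  show "integrable ?m (\<lambda>\<zeta>. \<phi> \<zeta> * (LINT \<eta>|N. ?K (torus_quotient \<zeta> \<eta>)))"
    using integrable_fst[OF int] by simp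
  show "integrable N (\<lambda>\<eta>. LINT w|?m. \<phi> (\<chi> j. \<eta> $ j * w $ j) * ?K w)"
    using integrable_snd[OF int]
    by (rule Bochner_Integration.integrable_cong[THEN iffD1, rotated 2]) (auto simp: rot)
  have "(LINT \<zeta>|?m. \<phi> \<zeta> * (LINT \<eta>|N. ?K (torus_quotient \<zeta> \<eta>))) =
      (LINT \<eta>|N. LINT \<zeta>|?m. \<phi> \<zeta> * ?K (torus_quotient \<zeta> \<eta>))"
    using Fubini_integral[OF int] by simp
  also have "\<dots> = (LINT \<eta>|N. LINT w|?m. \<phi> (\<chi> j. \<eta> $ j * w $ j) * ?K w)"
    by (intro Bochner_Integration.integral_cong refl rot)
  finally show "(LINT \<zeta>|?m. \<phi> \<zeta> * (LINT \<eta>|N. ?K (torus_quotient \<zeta> \<eta>))) =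
      (LINT \<eta>|N. LINT w|?m. \<phi> (\<chi> j. \<eta> $ j * w $ j) * ?K w)" .
qed

lemma tendsto_positive_poisson_integral:
  fixes \<alpha> \<beta> :: "complex ^ 'n::finite" and \<phi> :: "complex ^ 'n \<Rightarrow> complex"
  assumes pos: "\<And>j. Re (\<alpha> $ j) + Re (\<beta> $ j) > -1"
    and \<alpha>: "\<And>j. \<alpha> $ j + 1 \<notin> \<int>\<^sub>\<le>\<^sub>0" and \<beta>: "\<And>j. \<beta> $ j + 1 \<notin> \<int>\<^sub>\<le>\<^sub>0"
    and \<phi>: "continuous_on torus \<phi>"
    and fin: "finite_measure N" and N: "sets N = sets torus_borel"
  shows "((\<lambda>r. LINT \<zeta>|torus_haar. \<phi> \<zeta> * (LINT \<eta>|N. torus_kernel \<alpha> \<beta> r (torus_quotient \<zeta> \<eta>))) \<longlongrightarrow>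
    (LINT \<eta>|N. \<phi> \<eta>)) (at (\<chi> j. 1) within unit_cube)"
proof (rule tendstoI)
  interpret N: finite_measure N by fact
  fix e :: real assume e: "e > 0"
  define \<epsilon> where "\<epsilon> = e / (measure N (space N) + 1)"
  have "\<epsilon> > 0" using e by (simp add: \<epsilon>_def add_nonneg_pos)
  note approx = torus_kernel_approximate_identity[OF pos \<alpha> \<beta> \<phi> this]
  have total: "\<epsilon> * measure N (space N) < e"
  proof -
    have "\<epsilon> * measure N (space N) < \<epsilon> * (measure N (space N) + 1)"
      using \<open>\<epsilon> > 0\<close> by simp
    also have "\<dots> = e" using add_nonneg_pos[OF measure_nonneg[of N "space N"] zero_less_one] by (simp add: \<epsilon>_def)
    finally show ?thesis .
  qed
  show "\<forall>\<^sub>F r in at (\<chi> j. 1) within unit_cube.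
      dist (LINT \<zeta>|torus_haar. \<phi> \<zeta> * (LINT \<eta>|N. torus_kernel \<alpha> \<beta> r (torus_quotient \<zeta> \<eta>)))
        (LINT \<eta>|N. \<phi> \<eta>) < e"
    using approx eventually_unit_cube
  proof eventually_elim
    case (elim r)
    define g where "g \<eta> = (LINT w|torus_haar. \<phi> (\<chi> j. \<eta> $ j * w $ j) * torus_kernel \<alpha> \<beta> r w)" for \<eta>
    have g: "integrable N g"
      unfolding g_def by (rule torus_kernel_Fubini(2)[OF elim(2) \<phi> fin N])
    have int\<phi>: "integrable N \<phi>"
      by (rule continuous_on_torus_integrable[OF \<phi> N fin])
    have "dist (LINT \<eta>|N. g \<eta>) (LINT \<eta>|N. \<phi> \<eta>) = norm (LINT \<eta>|N. g \<eta> - \<phi> \<eta>)"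
      using g int\<phi> by (simp add: dist_norm)
    also have "\<dots> \<le> (LINT \<eta>|N. norm (g \<eta> - \<phi> \<eta>))"
      by (rule integral_norm_bound)
    also have "\<dots> \<le> (LINT \<eta>|N. \<epsilon>)"
    proof (intro integral_mono integrable_norm Bochner_Integration.integrable_diff g int\<phi>)
      show "norm (g \<eta> - \<phi> \<eta>) \<le> \<epsilon>" if "\<eta> \<in> space N" for \<eta>
        using elim(1) that N by (simp add: space_eq_torus g_def less_imp_le)
    qed simp
    also have "\<dots> < e" using total by (simp add: mult.commute)
    finally show ?case
      unfolding torus_kernel_Fubini(3)[OF elim(2) \<phi> fin N] g_def .
  qed
qed

theorem theorem3p13:
  fixes \<alpha> \<beta> :: "complex ^ 'n::finite"
    and \<mu> :: "(complex ^ 'n) set \<Rightarrow> complex"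
    and u :: "complex ^ 'n \<Rightarrow> complex"
  assumes "\<And>j. Re (\<alpha> $ j) + Re (\<beta> $ j) > -1"
    and "\<And>j. \<alpha> $ j \<notin> {- of_nat k | k. k \<ge> 1}"
    and "\<And>j. \<beta> $ j \<notin> {- of_nat k | k. k \<ge> 1}"
    and "complex_measure torus_borel \<mu>"
    and "\<And>z. z \<in> polydisc \<Longrightarrow> u z = poisson_integral \<alpha> \<beta> \<mu> z"
  shows "weak_star_tendsto torus (\<lambda>r. density_measure torus_haar (dilated u r)) \<mu>
           (at (\<chi> j. 1) within {r :: real ^ 'n. \<forall>j. 0 \<le> r $ j \<and> r $ j < 1})"
proof -
  define F where "F = at (\<chi> j. 1) within (unit_cube :: (real ^ 'n) set)"
  have \<alpha>: "\<alpha> $ j + 1 \<notin> \<int>\<^sub>\<le>\<^sub>0" and \<beta>: "\<beta> $ j + 1 \<notin> \<int>\<^sub>\<le>\<^sub>0" for j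
    using not_nonpos_Int_plus_1 assms(2,3) by blast+
  obtain N1 N2 N3 N4 where
    N: "finite_measure N1" "sets N1 = sets torus_borel" "finite_measure N2" "sets N2 = sets torus_borel"
      "finite_measure N3" "sets N3 = sets torus_borel" "finite_measure N4" "sets N4 = sets torus_borel"
    and dec: "\<And>f. complex_measure_integral torus_borel \<mu> f =
       ((LINT x|N1. f x) - (LINT x|N2. f x)) + \<i> * ((LINT x|N3. f x) - (LINT x|N4. f x))"
    using complex_measure_integral_decomposition[OF assms(4)] by metis
  define p where "p N r \<zeta> = (LINT \<eta>|N. torus_kernel \<alpha> \<beta> r (torus_quotient \<zeta> \<eta>))" for N r \<zeta>
  have u_eq: "dilated u r \<zeta> = (p N1 r \<zeta> - p N2 r \<zeta>) + \<i> * (p N3 r \<zeta> - p N4 r \<zeta>)"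
    if r: "r \<in> unit_cube" and \<zeta>: "\<zeta> \<in> torus" for r \<zeta>
  proof -
    have "(\<chi> j. complex_of_real (r $ j) * \<zeta> $ j) \<in> polydisc"
      using r \<zeta> by (simp add: unit_cube_def torus_def polydisc_def norm_mult)
    then show ?thesis
      using assms(5) by (simp add: dilated_def poisson_integral_def dec p_def poisson_kernel_dilation[OF \<zeta>])
  qed
  have int_p: "integrable torus_haar (\<lambda>\<zeta>. \<phi> \<zeta> * p N' r \<zeta>)"
    if "r \<in> unit_cube" "continuous_on torus \<phi>" "finite_measure N'" "sets N' = sets torus_borel"
    for r and \<phi> :: "complex ^ 'n \<Rightarrow> complex" and N'
    unfolding p_def using that by (rule torus_kernel_Fubini(1))
  have int_u: "integrable torus_haar (dilated u r)" if r: "r \<in> unit_cube" for r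
  proof -
    have "integrable torus_haar (\<lambda>\<zeta>. p N' r \<zeta>)" if "finite_measure N'" "sets N' = sets torus_borel" for N'
      using int_p[OF r continuous_on_const[of torus 1] that] by simp
    then have "integrable torus_haar (\<lambda>\<zeta>. (p N1 r \<zeta> - p N2 r \<zeta>) + \<i> * (p N3 r \<zeta> - p N4 r \<zeta>))"
      using N by (intro Bochner_Integration.integrable_add Bochner_Integration.integrable_diff
          integrable_mult_right) auto
    then show ?thesis
      by (rule Bochner_Integration.integrable_cong[THEN iffD1, rotated 2]) (auto simp: u_eq r space_eq_torus)
  qed
  have lim: "((\<lambda>r. complex_measure_integral torus_borel (density_measure torus_haar (dilated u r)) \<phi>) \<longlongrightarrow>
      complex_measure_integral torus_borel \<mu> \<phi>) F" if \<phi>: "continuous_on torus \<phi>" for \<phi>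
  proof -
    define q where "q N r = (LINT \<zeta>|torus_haar. \<phi> \<zeta> * p N r \<zeta>)" for N r
    obtain M where M: "\<And>\<zeta>. \<zeta> \<in> torus \<Longrightarrow> norm (\<phi> \<zeta>) \<le> M"
      using continuous_on_torus_bounded[OF \<phi>] by blast
    have "\<forall>\<^sub>F r in F. (q N1 r - q N2 r) + \<i> * (q N3 r - q N4 r) =
        complex_measure_integral torus_borel (density_measure torus_haar (dilated u r)) \<phi>"
      using eventually_unit_cube unfolding F_def
    proof eventually_elim
      case (elim r)
      have "complex_measure_integral torus_borel (density_measure torus_haar (dilated u r)) \<phi> =
          (LINT \<zeta>|torus_haar. \<phi> \<zeta> * dilated u r \<zeta>)"
        by (rule complex_measure_integral_density_measure[OF int_u[OF elim] sets_torus_haar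
              continuous_on_torus_measurable[OF \<phi> sets_torus_haar] M]) (simp add: space_eq_torus)
      also have "\<dots> = (LINT \<zeta>|torus_haar. (\<phi> \<zeta> * p N1 r \<zeta> - \<phi> \<zeta> * p N2 r \<zeta>) +
          \<i> * (\<phi> \<zeta> * p N3 r \<zeta> - \<phi> \<zeta> * p N4 r \<zeta>))"
        by (intro Bochner_Integration.integral_cong refl)
          (simp add: u_eq elim space_eq_torus algebra_simps)
      also have "\<dots> = (q N1 r - q N2 r) + \<i> * (q N3 r - q N4 r)"
        using int_p[OF elim \<phi> N(1,2)] int_p[OF elim \<phi> N(3,4)] int_p[OF elim \<phi> N(5,6)]
          int_p[OF elim \<phi> N(7,8)]
        by (simp add: q_def)
      finally show ?case by simp
    qed
    moreover have "(q N' \<longlongrightarrow> (LINT \<eta>|N'. \<phi> \<eta>)) F" if "finite_measure N'" "sets N' = sets torus_borel" for N'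
      unfolding q_def p_def F_def
      by (rule tendsto_positive_poisson_integral[OF assms(1) \<alpha> \<beta> \<phi> that])
    then have "((\<lambda>r. (q N1 r - q N2 r) + \<i> * (q N3 r - q N4 r)) \<longlongrightarrow> complex_measure_integral torus_borel \<mu> \<phi>) F"
      unfolding dec using N by (intro tendsto_intros) auto
    ultimately show ?thesis
      by (rule Lim_transform_eventually[rotated])
  qed
  have "\<forall>\<^sub>F r in F. complex_measure torus_borel (density_measure torus_haar (dilated u r))"
    using eventually_unit_cube unfolding F_def
    by eventually_elim (rule complex_measure_density_measure[OF int_u sets_torus_haar])
  with lim assms(4) show ?thesis
    unfolding weak_star_tendsto_def F_def unit_cube_def by blast
qed

end
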